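(* Let $X$ be a nonzero complex Banach space having a Schauder basis, let $1\le p<\infty$, let $n>1$ and let $\lambda\ge 1$. Then $$B(B_p^n,X,\lambda)\ \le\ \begin{cases}\lambda e^3 2^{3/2}\,\dfrac{(\log n)^{\frac12+\frac1p}}{n}, & \text{if } 1\le p\le 2,\\[2mm] \lambda e^3 2^{3/2}\left(\dfrac{\log n}{n}\right)^{\frac12+\frac1p}, & \text{if } 2\le p<\infty.\end{cases}$$
   Context: For $1\le p\le\infty$, $B_p^n=\{z\in\mathbb{C}^n:\|z\|_p<1\}$, where $\|\cdot\|_p$ is the usual $\ell_p$-norm on $\mathbb{C}^n$. A domain $\Omega\subseteq\mathbb{C}^n$ is complete Reinhardt if $(z_1,\dots,z_n)\in\Omega$ and $|\lambda_k|\le 1$ for all $k$ imply $(\lambda_1z_1,\dots,\lambda_nz_n)\in\Omega$. Multi-indices: $\alpha\in\mathbb{N}_0^n$, $z^\alpha=z_1^{\alpha_1}\cdots z_n^{\alpha_n}$. For $r\ge 0$, $r\cdot\Omega=\{rz:z\in\Omega\}$. Definition ($\lambda$-second Bohr radius of $X$, i.e. of the identity operator on $X$). Let $\Omega\subset\mathbb{C}^n$ be a bounded complete Reinhardt domain, $X$ a nonzero complex Banach space and $\lambda\ge 1$. $B(\Omega,X,\lambda)$ is the largest $r\ge 0$ such that $$\sum_{\alpha\in\mathbb{N}_0^n}\ \sup_{z\in r\cdot\Omega}\|a_\alpha z^\alpha\|_X\ \le\ \lambda\sup_{z\in\Omega}\|f(z)\|_X$$ for every (bounded) holomorphic $f:\Omega\to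 X$ with power series expansion $f(z)=\sum_{\alpha\in\mathbb{N}_0^n}a_\alpha z^\alpha$, $a_\alpha\in X$. *)

theory Defs
  imports "HOL-Analysis.Analysis" "HOL-Library.Extended_Nat"
begin

class complex_vector = real_vector +
  fixes scaleC :: "complex \<Rightarrow> 'a \<Rightarrow> 'a" (infixr "*\<^sub>C" 75)
  assumes scaleC_add_right: "c *\<^sub>C (x + y) = c *\<^sub>C x + c *\<^sub>C y"
    and scaleC_add_left: "(c + d) *\<^sub>C x = c *\<^sub>C x + d *\<^sub>C x"
    and scaleC_scaleC: "c *\<^sub>C d *\<^sub>C x = (c * d) *\<^sub>C x"
    and scaleC_one: "1 *\<^sub>C x = x"
    and scaleR_scaleC: "r *\<^sub>R x = complex_of_real r *\<^sub>C x"

class complex_normed_vector = complex_vector + real_normed_vector +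
  assumes norm_scaleC: "norm (c *\<^sub>C x) = cmod c * norm x"

class complex_banach = complex_normed_vector + banach

instantiation complex :: complex_banach
begin

definition scaleC_complex :: "complex \<Rightarrow> complex \<Rightarrow> complex" where
  "scaleC_complex c x = c * x"

instance
  by standard (simp_all add: scaleC_complex_def algebra_simps norm_mult scaleR_conv_of_real)

end

text \<open>
  A basis is a sequence \<open>e 0, e 1, \<dots>\<close> of length \<open>N \<le> \<infinity>\<close>, so that finite-dimensional spaces
  have bases too. Entries of \<open>e\<close> at positions \<open>k \<ge> N\<close> play no role.
\<close>

definition schauder_basis :: "enat \<Rightarrow> (nat \<Rightarrow> 'x::complex_banach) \<Rightarrow> bool" where
  "schauder_basis N e \<longleftrightarrow>
     (\<forall>x. \<exists>!c. (\<forall>k. N \<le> enat k \<longrightarrow> c k = 0) \<and> (\<lambda>k. c k *\<^sub>C e k) sums x)"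

definition lp_norm :: "real \<Rightarrow> complex ^ 'n \<Rightarrow> real" where
  "lp_norm p z = (\<Sum>i\<in>UNIV. cmod (z $ i) powr p) powr (1 / p)"

definition lp_ball :: "real \<Rightarrow> (complex ^ 'n) set" where
  "lp_ball p = {z. lp_norm p z < 1}"

definition mpower :: "complex ^ 'n \<Rightarrow> ('n \<Rightarrow> nat) \<Rightarrow> complex" where
  "mpower z \<alpha> = (\<Prod>i\<in>UNIV. (z $ i) ^ \<alpha> i)"

text \<open>
  Holomorphy is complex Frechet differentiability: the derivative is complex linear, where
  \<open>c *s v\<close> is the complex scalar multiplication of \<open>complex ^ 'n\<close>.
\<close>

definition holomorphic_vec_on :: "(complex ^ 'n \<Rightarrow> 'x::complex_banach) \<Rightarrow> (complex ^ 'n) set \<Rightarrow> bool" where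
  "holomorphic_vec_on f \<Omega> \<longleftrightarrow>
     (\<forall>z\<in>\<Omega>. \<exists>D. (f has_derivative D) (at z) \<and> (\<forall>c v. D (c *s v) = c *\<^sub>C D v))"

definition power_series_expansion_on ::
    "(complex ^ 'n \<Rightarrow> 'x::complex_banach) \<Rightarrow> (('n \<Rightarrow> nat) \<Rightarrow> 'x) \<Rightarrow> (complex ^ 'n) set \<Rightarrow> bool" where
  "power_series_expansion_on f a \<Omega> \<longleftrightarrow> (\<forall>z\<in>\<Omega>. ((\<lambda>\<alpha>. mpower z \<alpha> *\<^sub>C a \<alpha>) has_sum f z) UNIV)"

text \<open>
  Suprema and the sum over all multi-indices are taken in \<open>[0, \<infinity>]\<close>, where they always exist;
  over the reals a divergent sum or an unbounded supremum would be a junk value.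
\<close>

definition bohr_inequality ::
    "'x::complex_banach itself \<Rightarrow> (complex ^ 'n) set \<Rightarrow> real \<Rightarrow> real \<Rightarrow> bool" where
  "bohr_inequality X \<Omega> L r \<longleftrightarrow>
     (\<forall>(f :: complex ^ 'n \<Rightarrow> 'x) a.
        holomorphic_vec_on f \<Omega> \<and> bounded (f ` \<Omega>) \<and> power_series_expansion_on f a \<Omega> \<longrightarrow>
        (\<Sum>\<^sub>\<infinity>\<alpha>. SUP z\<in>(\<lambda>z. r *\<^sub>R z) ` \<Omega>. ennreal (norm (mpower z \<alpha> *\<^sub>C a \<alpha>)))
          \<le> ennreal L * (SUP z\<in>\<Omega>. ennreal (norm (f z))))"

text \<open>
  Meant for a bounded complete Reinhardt domain \<open>\<Omega>\<close>, a nonzero space and \<open>L \<ge> 1\<close>: then every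
  bounded holomorphic function has exactly one power series expansion on \<open>\<Omega>\<close>, and the largest
  \<open>r\<close> exists.
\<close>

definition bohr_radius :: "(complex ^ 'n) set \<Rightarrow> 'x::complex_banach itself \<Rightarrow> real \<Rightarrow> real" where
  "bohr_radius \<Omega> X L = (GREATEST r. 0 \<le> r \<and> bohr_inequality X \<Omega> L r)"

end

theory Submission
  imports Defs "HOL-Combinatorics.Multiset_Permutations"
begin

text \<open>
  Since \<open>X\<close> contains a copy of the scalars, it is enough to test the Bohr inequality on one scalar
  \<open>m\<close>-homogeneous polynomial \<open>\<Sum> \<plusminus> (m!/\<alpha>!) z\<^sup>\<alpha>\<close> with \<open>m \<approx> ln n\<close>. On the Euclidean unit ball the
  sum of the squared moduli of its terms is at most \<open>m!\<close>, so an exponential moment estimate over a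
  fine grid yields signs for which the polynomial is at most \<open>7 \<surd>m! m \<surd>n\<close> there, whose \<open>m\<close>-th root is
  of order \<open>\<surd>(ln n)\<close>. For \<open>p \<le> 2\<close> the \<open>\<ell>\<^sub>p\<close> ball lies in the Euclidean one; for \<open>p \<ge> 2\<close> it lies in its
  multiple by \<open>n\<close> to the power \<open>1/2 - 1/p\<close>. On the other side every monomial of degree \<open>m\<close> has
  supremum at least \<open>1/m\<close> to the power \<open>m/p\<close> on the \<open>\<ell>\<^sub>p\<close> ball, and the multinomial coefficients sum to
  \<open>n\<^sup>m\<close>; taking \<open>m\<close>-th roots gives the bound.
\<close>

section \<open>Sign choices and nets\<close>

text \<open>The function exp(-u^2/2) cosh u is nonincreasing for u \<ge> 0 and equals 1 at 0: its
  derivative has the sign of sinh u - u cosh u, which is nonpositive. Evenness settles negative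
  arguments. This is the exponential moment estimate for a random sign.\<close>

lemma cosh_le_exp_square: "cosh x \<le> exp (x\<^sup>2 / 2)" for x :: real
proof -
  have nonneg: "cosh y \<le> exp (y\<^sup>2 / 2)" if "0 \<le> y" for y :: real
  proof -
    have sinh_le: "sinh t \<le> t * cosh t" if "0 \<le> t" for t :: real
    proof -
      have "(\<lambda>u. u * cosh u - sinh u) 0 \<le> (\<lambda>u. u * cosh u - sinh u) t"
      proof (rule DERIV_nonneg_imp_nondecreasing[OF that])
        fix u :: real assume "0 \<le> u" "u \<le> t"
        then show "\<exists>d. ((\<lambda>u. u * cosh u - sinh u) has_real_derivative d) (at u) \<and> 0 \<le> d"
          by (intro exI[of _ "u * sinh u"]) (auto intro!: derivative_eq_intros)
      qed
      then show ?thesis by simp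
    qed
    have "(\<lambda>u. exp (- (u\<^sup>2 / 2)) * cosh u) y \<le> (\<lambda>u. exp (- (u\<^sup>2 / 2)) * cosh u) 0"
    proof (rule DERIV_nonpos_imp_nonincreasing[OF that])
      fix u :: real assume "0 \<le> u" "u \<le> y"
      then show "\<exists>d. ((\<lambda>u. exp (- (u\<^sup>2 / 2)) * cosh u) has_real_derivative d) (at u) \<and> d \<le> 0"
        using sinh_le[of u]
        by (intro exI[of _ "exp (- (u\<^sup>2 / 2)) * (sinh u - u * cosh u)"])
           (auto intro!: derivative_eq_intros mult_nonneg_nonpos simp: algebra_simps)
    qed
    then show ?thesis by (simp add: exp_minus field_simps)
  qed
  show ?thesis using nonneg[of x] nonneg[of "-x"] by (cases "0 \<le> x") auto
qed

text \<open>The method of conditional expectations: the signs are fixed one at a time, never exceeding the mean.\<close>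

lemma exists_signs_exp_sum_le:
  fixes c :: "'w \<Rightarrow> real" and v :: "'w \<Rightarrow> 'a \<Rightarrow> real"
  assumes "finite A" and "\<And>w. w \<in> W \<Longrightarrow> 0 \<le> c w"
  shows "\<exists>\<epsilon>. (\<forall>a. \<epsilon> a \<in> {1, -1 :: real}) \<and>
           (\<Sum>w\<in>W. c w * exp (\<Sum>a\<in>A. \<epsilon> a * v w a)) \<le> (\<Sum>w\<in>W. c w * exp ((\<Sum>a\<in>A. (v w a)\<^sup>2) / 2))"
  using assms
proof (induction A arbitrary: c rule: finite_induct)
  case empty
  then show ?case by (intro exI[of _ "\<lambda>_. 1"]) auto
next
  case (insert b A)
  \<comment> \<open>The weights are arbitrary in the induction, so the factor contributed by the new
    index \<open>b\<close> can be absorbed into \<open>c\<close> before the hypothesis is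
    applied.\<close>
  obtain \<epsilon> where \<epsilon>: "\<forall>a. \<epsilon> a \<in> {1, -1}"
    and le: "(\<Sum>w\<in>W. (c w * exp ((v w b)\<^sup>2 / 2)) * exp (\<Sum>a\<in>A. \<epsilon> a * v w a))
      \<le> (\<Sum>w\<in>W. (c w * exp ((v w b)\<^sup>2 / 2)) * exp ((\<Sum>a\<in>A. (v w a)\<^sup>2) / 2))"
    using insert.IH[of "\<lambda>w. c w * exp ((v w b)\<^sup>2 / 2)"] insert.prems by auto
  define S where "S s = (\<Sum>w\<in>W. c w * exp (\<Sum>a\<in>insert b A. (\<epsilon>(b := s)) a * v w a))" for s
  define R where "R = (\<Sum>w\<in>W. c w * exp ((\<Sum>a\<in>insert b A. (v w a)\<^sup>2) / 2))"
  have S: "S s = (\<Sum>w\<in>W. c w * (exp (s * v w b) * exp (\<Sum>a\<in>A. \<epsilon> a * v w a)))" for s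
  proof -
    have "(\<Sum>a\<in>A. (\<epsilon>(b := s)) a * v w a) = (\<Sum>a\<in>A. \<epsilon> a * v w a)" for w
      using insert.hyps by (intro sum.cong) auto
    then show ?thesis
      unfolding S_def using insert.hyps by (simp add: exp_add)
  qed
  \<comment> \<open>Averaging over the sign at \<open>b\<close> turns the two exponentials into
    cosh; if the average is at most \<open>R\<close>, so is one of the two values.\<close>
  have "(S 1 + S (-1)) / 2 = (\<Sum>w\<in>W. c w * (cosh (v w b) * exp (\<Sum>a\<in>A. \<epsilon> a * v w a)))"
    unfolding S sum.distrib[symmetric] sum_divide_distrib
    by (intro sum.cong) (auto simp: cosh_field_def field_simps)
  also have "\<dots> \<le> (\<Sum>w\<in>W. c w * (exp ((v w b)\<^sup>2 / 2) * exp (\<Sum>a\<in>A. \<epsilon> a * v w a)))"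
    using insert.prems by (intro sum_mono mult_left_mono mult_right_mono cosh_le_exp_square) auto
  also have "\<dots> \<le> R"
    using le insert.hyps by (simp add: R_def exp_add add_divide_distrib mult.assoc)
  finally have "S 1 + S (-1) \<le> 2 * R" by (simp add: divide_le_eq mult.commute)
  then consider "S 1 \<le> R" | "S (-1) \<le> R" by fastforce
  then obtain s where s: "s \<in> {1, -1}" "S s \<le> R" by cases auto
  show ?case
    using \<epsilon> s(1) by (intro exI[of _ "\<epsilon>(b := s)"] conjI s(2)[unfolded S_def R_def]) auto
qed

text \<open>A Chernoff bound combined with a union bound over \<open>G\<close> and four directions.
  The exponential sum over all pairs is at most \<open>4 * card G * exp H\<close>, hence at most
  \<open>exp (2 * H)\<close>; all its terms are positive, so each single exponent is at most
  \<open>2 * H\<close>.\<close>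

lemma exists_signs_sum_le:
  fixes b :: "'w \<Rightarrow> 'a \<Rightarrow> complex"
  assumes "finite A" "finite G" "0 < \<sigma>" "0 < H"
    and var: "\<And>w. w \<in> G \<Longrightarrow> (\<Sum>a\<in>A. (cmod (b w a))\<^sup>2) \<le> \<sigma>\<^sup>2"
    and card: "4 * real (card G) \<le> exp H"
  shows "\<exists>\<epsilon>. (\<forall>a. \<epsilon> a \<in> {1, -1 :: real}) \<and>
           (\<forall>w\<in>G. cmod (\<Sum>a\<in>A. of_real (\<epsilon> a) * b w a) \<le> 2 * sqrt H * \<sigma>)"
proof -
  \<comment> \<open>These four directions turn upper bounds for \<open>Re (u * F)\<close> into
    bounds for the absolute values of the real and imaginary parts of \<open>F\<close>.\<close>
  define U where "U = {1, -1, \<i>, -\<i>}"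
  \<comment> \<open>This scale makes the variance term s^2 \<sigma>^2 / 2 equal to \<open>H\<close>,
    and dividing the exponent bound \<open>2 * H\<close> by \<open>s\<close> leaves
    \<open>sqrt (2 * H) * \<sigma>\<close>.\<close>
  define s where "s = sqrt (2 * H) / \<sigma>"
  have s: "0 < s" using assms by (simp add: s_def)
  have s\<sigma>: "s\<^sup>2 * \<sigma>\<^sup>2 = 2 * H" using assms by (simp add: s_def power_divide)
  have "card U = 4"
    unfolding U_def by (subst card_insert_disjoint; simp add: complex_eq_iff)+
  define v where "v wu a = s * Re (snd wu * b (fst wu) a)" for wu a
  obtain \<epsilon> where \<epsilon>: "\<forall>a. \<epsilon> a \<in> {1, -1 :: real}" and
    "(\<Sum>w\<in>G\<times>U. 1 * exp (\<Sum>a\<in>A. \<epsilon> a * v w a)) \<le> (\<Sum>w\<in>G\<times>U. 1 * exp ((\<Sum>a\<in>A. (v w a)\<^sup>2) / 2))"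
    using exists_signs_exp_sum_le[OF \<open>finite A\<close>, of "G \<times> U" "\<lambda>_. 1" v] by auto
  moreover have "(\<Sum>w\<in>G\<times>U. 1 * exp ((\<Sum>a\<in>A. (v w a)\<^sup>2) / 2)) \<le> (\<Sum>w\<in>G\<times>U. exp H)"
  proof (intro sum_mono)
    fix wu assume "wu \<in> G \<times> U"
    then have wu: "fst wu \<in> G" "cmod (snd wu) = 1" by (auto simp: U_def)
    have "(\<Sum>a\<in>A. (v wu a)\<^sup>2) \<le> (\<Sum>a\<in>A. s\<^sup>2 * (cmod (b (fst wu) a))\<^sup>2)"
    proof (intro sum_mono)
      fix a
      have "\<bar>Re (snd wu * b (fst wu) a)\<bar> \<le> cmod (b (fst wu) a)"
        using abs_Re_le_cmod[of "snd wu * b (fst wu) a"] wu by (simp add: norm_mult)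
      then show "(v wu a)\<^sup>2 \<le> s\<^sup>2 * (cmod (b (fst wu) a))\<^sup>2"
        using power_mono[of "\<bar>Re (snd wu * b (fst wu) a)\<bar>" _ 2]
        by (auto simp: v_def power_mult_distrib intro!: mult_left_mono)
    qed
    also have "\<dots> \<le> s\<^sup>2 * \<sigma>\<^sup>2"
      using var[OF wu(1)] by (simp add: sum_distrib_left[symmetric] mult_left_mono)
    finally show "1 * exp ((\<Sum>a\<in>A. (v wu a)\<^sup>2) / 2) \<le> exp H"
      by (simp add: s\<sigma>)
  qed
  moreover have "(\<Sum>w\<in>G\<times>U. exp H) = 4 * real (card G) * exp H"
    by (simp add: card_cartesian_product \<open>card U = 4\<close>)
  moreover have "4 * real (card G) * exp H \<le> exp (2 * H)"
    unfolding mult_2[of H] exp_add using card by (rule mult_right_mono) simp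
  ultimately have total: "(\<Sum>w\<in>G\<times>U. exp (\<Sum>a\<in>A. \<epsilon> a * v w a)) \<le> exp (2 * H)"
    unfolding mult_1 by linarith
  have "cmod (\<Sum>a\<in>A. of_real (\<epsilon> a) * b w a) \<le> 2 * sqrt H * \<sigma>" if w: "w \<in> G" for w
  proof -
    define F where "F = (\<Sum>a\<in>A. of_real (\<epsilon> a) * b w a)"
    have Re_le: "Re (u * F) \<le> sqrt (2 * H) * \<sigma>" if u: "u \<in> U" for u
    proof -
      have "exp (\<Sum>a\<in>A. \<epsilon> a * v (w, u) a) \<le> (\<Sum>w\<in>G\<times>U. exp (\<Sum>a\<in>A. \<epsilon> a * v w a))"
        using w u assms by (intro member_le_sum) (auto simp: U_def)
      with total have "(\<Sum>a\<in>A. \<epsilon> a * v (w, u) a) \<le> 2 * H"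
        by (meson exp_le_cancel_iff order_trans)
      also have "(\<Sum>a\<in>A. \<epsilon> a * v (w, u) a) = s * Re (u * F)"
        unfolding v_def F_def sum_distrib_left Re_sum
        by (intro sum.cong) (auto simp: algebra_simps)
      also have "2 * H = s * (sqrt (2 * H) * \<sigma>)"
        using assms by (simp add: s_def)
      finally show ?thesis using s by (simp only: mult_le_cancel_left_pos)
    qed
    have "\<bar>Re F\<bar> \<le> sqrt (2 * H) * \<sigma>" "\<bar>Im F\<bar> \<le> sqrt (2 * H) * \<sigma>"
      using Re_le[of 1] Re_le[of "-1"] Re_le[of "\<i>"] Re_le[of "-\<i>"] by (auto simp: U_def)
    then have "(Re F)\<^sup>2 \<le> (sqrt (2 * H) * \<sigma>)\<^sup>2" "(Im F)\<^sup>2 \<le> (sqrt (2 * H) * \<sigma>)\<^sup>2"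
      by (auto intro: power2_le_iff_abs_le[THEN iffD2] order_trans[OF abs_ge_zero])
    then have "(cmod F)\<^sup>2 \<le> (2 * sqrt H * \<sigma>)\<^sup>2"
      using assms by (simp add: cmod_power2 power_mult_distrib)
    then show ?thesis
      unfolding F_def[symmetric] by (rule power2_le_imp_le) (use assms in simp)
  qed
  with \<epsilon> show ?thesis by blast
qed

section \<open>Grid nets in the Euclidean unit ball\<close>

lemma norm_coord_le_one:
  fixes z :: "complex ^ 'n::finite"
  assumes "(\<Sum>i\<in>UNIV. (cmod (z $ i))\<^sup>2) \<le> 1"
  shows "cmod (z $ i) \<le> 1"
proof -
  have "(cmod (z $ i))\<^sup>2 \<le> (\<Sum>i\<in>UNIV. (cmod (z $ i))\<^sup>2)" by (rule member_le_sum) auto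
  with assms have "(cmod (z $ i))\<^sup>2 \<le> 1\<^sup>2" by simp
  then show ?thesis by (rule power2_le_imp_le) simp
qed

text \<open>The net consists of the points in the ball whose coordinates have real and imaginary
  parts j/N with |j| \<le> N, that is, 2N + 1 choices for each of 2n real parameters. Rounding moves
  each real parameter by at most 1/N. The net has to lie inside the ball because the variance bound
  is needed at its points.\<close>

lemma exists_grid_net:
  assumes "0 < N"
  shows "\<exists>G :: (complex ^ 'n::finite) set. finite G \<and> card G \<le> (2 * N + 1) ^ (2 * CARD('n)) \<and>
    (\<forall>w\<in>G. (\<Sum>i\<in>UNIV. (cmod (w $ i))\<^sup>2) \<le> 1) \<and>
    (\<forall>z. (\<Sum>i\<in>UNIV. (cmod (z $ i))\<^sup>2) \<le> 1 \<longrightarrow> (\<exists>w\<in>G. \<forall>i. cmod (z $ i - w $ i) \<le> 2 / real N))"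
proof -
  define I where "I = {- int N..int N} \<times> {- int N..int N}"
  define pt :: "('n \<Rightarrow> int \<times> int) \<Rightarrow> complex ^ 'n"
    where "pt k = (\<chi> i. Complex (of_int (fst (k i)) / real N) (of_int (snd (k i)) / real N))" for k
  define G where "G = pt ` (PiE UNIV (\<lambda>_. I)) \<inter> {w. (\<Sum>i\<in>UNIV. (cmod (w $ i))\<^sup>2) \<le> 1}"
  \<comment> \<open>Rounding towards zero, so that grid approximations stay in the ball.\<close>
  define rnd :: "real \<Rightarrow> int" where "rnd x = (if 0 \<le> x then \<lfloor>real N * x\<rfloor> else - \<lfloor>real N * - x\<rfloor>)" for x
  have rnd_le: "\<bar>of_int (rnd x) / real N\<bar> \<le> \<bar>x\<bar>" for x
  proof (cases "0 \<le> x")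
    case True
    then show ?thesis using assms by (simp add: rnd_def divide_le_eq mult.commute)
  next
    case False
    then have "0 \<le> real N * - x" by (simp add: mult_nonneg_nonpos)
    then have "0 \<le> \<lfloor>real N * - x\<rfloor>" by (simp only: zero_le_floor)
    moreover have "of_int \<lfloor>real N * - x\<rfloor> \<le> N * - x" by (rule of_int_floor_le)
    ultimately show ?thesis using False assms
      by (simp add: rnd_def divide_le_eq mult.commute)
  qed
  have rnd_diff: "\<bar>x - of_int (rnd x) / real N\<bar> \<le> 1 / real N" for x
  proof -
    have "\<bar>N * x - of_int (rnd x)\<bar> \<le> 1"
      unfolding rnd_def by (simp; linarith)
    then have "\<bar>N * x - of_int (rnd x)\<bar> / N \<le> 1 / N" by (simp add: divide_right_mono)
    also have "\<bar>N * x - of_int (rnd x)\<bar> / N = \<bar>(N * x - of_int (rnd x)) / N\<bar>" by simp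
    also have "(N * x - of_int (rnd x)) / N = x - of_int (rnd x) / real N"
      using assms by (simp add: field_simps)
    finally show ?thesis .
  qed
  have finP: "finite (PiE (UNIV :: 'n set) (\<lambda>_. I))"
    by (intro finite_PiE) (auto simp: I_def)
  then have "finite G" by (auto simp: G_def)
  moreover have "card G \<le> (2 * N + 1) ^ (2 * CARD('n))"
  proof -
    have "card G \<le> card (PiE (UNIV :: 'n set) (\<lambda>_. I))"
      unfolding G_def using finP by (meson card_image_le card_mono finite_imageI inf_le1 order_trans)
    also have "\<dots> = card I ^ CARD('n)" by (simp add: card_PiE)
    also have "card I = (2 * N + 1)\<^sup>2"
      by (simp add: I_def card_cartesian_product power2_eq_square nat_add_distrib nat_mult_distrib)
    finally show ?thesis by (simp add: power_mult)
  qed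
  moreover have "\<exists>w\<in>G. \<forall>i. cmod (z $ i - w $ i) \<le> 2 / real N"
    if z: "(\<Sum>i\<in>UNIV. (cmod (z $ i))\<^sup>2) \<le> 1" for z :: "complex ^ 'n"
  proof -
    define k where "k i = (rnd (Re (z $ i)), rnd (Im (z $ i)))" for i
    have sq: "(cmod (pt k $ i))\<^sup>2 \<le> (cmod (z $ i))\<^sup>2" for i
      unfolding cmod_power2 pt_def k_def
      using add_mono[OF rnd_le[of "Re (z $ i)", unfolded abs_le_square_iff]
          rnd_le[of "Im (z $ i)", unfolded abs_le_square_iff]] by simp
    have le1: "cmod (z $ i) \<le> 1" for i using z by (rule norm_coord_le_one)
    have rnd_mem: "rnd x \<in> {- int N..int N}" if "\<bar>x\<bar> \<le> 1" for x
    proof -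
      have "\<bar>of_int (rnd x) / real N\<bar> \<le> 1" using rnd_le[of x] that by linarith
      then have "real_of_int \<bar>rnd x\<bar> \<le> real_of_int (int N)" using assms by (simp add: divide_le_eq)
      then have "\<bar>rnd x\<bar> \<le> int N" by linarith
      then show ?thesis by auto
    qed
    have "k \<in> PiE UNIV (\<lambda>_. I)"
    proof (rule PiE_I)
      fix i
      have "\<bar>Re (z $ i)\<bar> \<le> 1" "\<bar>Im (z $ i)\<bar> \<le> 1"
        using le1[of i] abs_Re_le_cmod[of "z $ i"] abs_Im_le_cmod[of "z $ i"] by linarith+
      then show "k i \<in> I"
        unfolding k_def I_def using rnd_mem by blast
    qed simp
    moreover have "(\<Sum>i\<in>UNIV. (cmod (pt k $ i))\<^sup>2) \<le> 1"
      using order_trans[OF sum_mono[of UNIV, OF sq] z] .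
    ultimately have "pt k \<in> G" by (auto simp: G_def)
    moreover have "cmod (z $ i - pt k $ i) \<le> 2 / real N" for i
      using cmod_le[of "z $ i - pt k $ i"] rnd_diff[of "Re (z $ i)"] rnd_diff[of "Im (z $ i)"]
      by (simp add: pt_def k_def)
    ultimately show ?thesis by blast
  qed
  ultimately show ?thesis by (intro exI[of _ G]) (auto simp: G_def)
qed

section \<open>Homogeneous polynomials with multinomial coefficients\<close>

text \<open>For \<alpha> of degree m over a finite index type, the number of these words is the
  multinomial coefficient m!/\<alpha>!.\<close>

definition arrangements :: "('n \<Rightarrow> nat) \<Rightarrow> 'n list set" where
  "arrangements \<alpha> = {xs. count_list xs = \<alpha>}"

text \<open>Over a finite index type these are all multi-indices of degree m. Encoding them as
  letter counts of words lets a sum over words be grouped by multi-index directly.\<close>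

definition degree_indices :: "nat \<Rightarrow> ('n \<Rightarrow> nat) set" where
  "degree_indices m = count_list ` {xs. length xs = m}"

lemma finite_lists_of_length: "finite {xs :: 'n::finite list. length xs = m}"
  using finite_lists_length_eq[of "UNIV :: 'n set" m] by simp

lemma finite_degree_indices: "finite (degree_indices m :: ('n::finite \<Rightarrow> nat) set)"
  unfolding degree_indices_def by (intro finite_imageI finite_lists_of_length)

lemma sum_degree_indices:
  fixes \<alpha> :: "'n::finite \<Rightarrow> nat"
  shows "\<alpha> \<in> degree_indices m \<Longrightarrow> (\<Sum>i\<in>UNIV. \<alpha> i) = m"
  unfolding degree_indices_def by (auto simp: sum_count_set)

text \<open>The words counted are the orderings of a single multiset of size m, so their number is
  m! divided by a product of factorials.\<close>

lemma card_arrangements_le: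
  fixes \<alpha> :: "'n::finite \<Rightarrow> nat"
  assumes "\<alpha> \<in> degree_indices m"
  shows "card (arrangements \<alpha>) \<le> fact m"
proof -
  obtain xs where xs: "length xs = m" "\<alpha> = count_list xs"
    using assms by (auto simp: degree_indices_def)
  have "arrangements \<alpha> = permutations_of_multiset (mset xs)"
    unfolding arrangements_def permutations_of_multiset_def xs(2)
    by (auto simp: multiset_eq_iff fun_eq_iff simp flip: count_mset)
  then show ?thesis
    using xs(1) by (simp add: card_permutations_of_multiset)
qed

lemma prod_power_count_list:
  fixes y :: "'n::finite \<Rightarrow> 'a::comm_semiring_1"
  shows "(\<Prod>i\<in>UNIV. y i ^ count_list xs i) = (\<Prod>x\<leftarrow>xs. y x)"
proof (induction xs)
  case (Cons x xs)
  have "(\<Prod>i\<in>UNIV. y i ^ count_list (x # xs) i) = (\<Prod>i\<in>UNIV. (if i = x then y i else 1) * y i ^ count_list xs i)"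
    by (intro prod.cong) auto
  also have "\<dots> = y x * (\<Prod>i\<in>UNIV. y i ^ count_list xs i)"
    by (simp add: prod.distrib)
  finally show ?case using Cons.IH by simp
qed simp

lemma sum_prod_list_of_length:
  fixes y :: "'n::finite \<Rightarrow> 'a::comm_semiring_1"
  shows "(\<Sum>xs | length xs = m. \<Prod>x\<leftarrow>xs. y x) = (\<Sum>i\<in>UNIV. y i) ^ m"
proof (induction m)
  case (Suc m)
  have img: "{xs :: 'n list. length xs = Suc m} = (\<lambda>(x, xs). x # xs) ` (UNIV \<times> {xs. length xs = m})"
    by (auto simp: length_Suc_conv)
  have inj: "inj_on (\<lambda>(x, xs). x # xs) (UNIV \<times> {xs :: 'n list. length xs = m})"
    by (auto simp: inj_on_def)
  have "(\<Sum>xs | length xs = Suc m. \<Prod>x\<leftarrow>xs. y x)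
      = (\<Sum>(x, xs)\<in>UNIV \<times> {xs. length xs = m}. y x * (\<Prod>x\<leftarrow>xs. y x))"
    unfolding img sum.reindex[OF inj] by (rule sum.cong) auto
  also have "\<dots> = (\<Sum>x\<in>UNIV. \<Sum>xs | length xs = m. y x * (\<Prod>x\<leftarrow>xs. y x))"
    by (rule sum.cartesian_product[symmetric])
  also have "\<dots> = (\<Sum>i\<in>UNIV. y i) ^ Suc m"
    unfolding sum_product[symmetric] Suc by simp
  finally show ?case .
qed simp

text \<open>The m-th power expands into a sum over words of length m, and words with the same letter
  counts contribute the same monomial.\<close>

lemma multinomial_expansion:
  fixes y :: "'n::finite \<Rightarrow> 'a::comm_semiring_1"
  shows "(\<Sum>\<alpha>\<in>degree_indices m. of_nat (card (arrangements \<alpha>)) * (\<Prod>i\<in>UNIV. y i ^ \<alpha> i)) = (\<Sum>i\<in>UNIV. y i) ^ m"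
proof -
  have "(\<Sum>i\<in>UNIV. y i) ^ m = (\<Sum>xs | length xs = m. \<Prod>i\<in>UNIV. y i ^ count_list xs i)"
    by (simp add: sum_prod_list_of_length prod_power_count_list)
  also have "\<dots> = (\<Sum>\<alpha>\<in>degree_indices m. \<Sum>xs | xs \<in> {xs. length xs = m} \<and> count_list xs = \<alpha>. \<Prod>i\<in>UNIV. y i ^ count_list xs i)"
    unfolding degree_indices_def by (rule sum.image_gen) (rule finite_lists_of_length)
  also have "\<dots> = (\<Sum>\<alpha>\<in>degree_indices m. of_nat (card (arrangements \<alpha>)) * (\<Prod>i\<in>UNIV. y i ^ \<alpha> i))"
  proof (intro sum.cong refl)
    fix \<alpha> :: "'n \<Rightarrow> nat" assume "\<alpha> \<in> degree_indices m"
    \<comment> \<open>The length condition is automatic once the letter counts are \<alpha>, since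
      the counts add up to the length.\<close>
    then have "{xs. xs \<in> {xs. length xs = m} \<and> count_list xs = \<alpha>} = arrangements \<alpha>"
      unfolding arrangements_def
      using sum_degree_indices sum_count_set[of _ "UNIV :: 'n set"] by fastforce
    then show "(\<Sum>xs | xs \<in> {xs. length xs = m} \<and> count_list xs = \<alpha>. \<Prod>i\<in>UNIV. y i ^ count_list xs i)
        = of_nat (card (arrangements \<alpha>)) * (\<Prod>i\<in>UNIV. y i ^ \<alpha> i)"
      by (simp add: arrangements_def)
  qed
  finally show ?thesis by simp
qed

lemma sum_card_arrangements:
  "(\<Sum>\<alpha>\<in>degree_indices m. card (arrangements (\<alpha> :: 'n::finite \<Rightarrow> nat))) = CARD('n) ^ m"
  using multinomial_expansion[where 'a = nat and y = "\<lambda>_::'n. 1" and m = m] by simp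

section \<open>The signed polynomial and its size on the Euclidean unit ball\<close>

lemma norm_mpower: "cmod (mpower z \<alpha>) = (\<Prod>i\<in>UNIV. cmod (z $ i) ^ \<alpha> i)"
  by (simp add: mpower_def norm_power prod_norm[symmetric])

lemma mpower_scaleR: "mpower (t *\<^sub>R z) \<alpha> = of_real t ^ (\<Sum>i\<in>UNIV. \<alpha> i) * mpower z \<alpha>"
  unfolding mpower_def vector_scaleR_component scaleR_conv_of_real[where 'a = complex] power_mult_distrib prod.distrib power_sum ..

text \<open>All factors have modulus at most 1, so the difference of the products is at most the sum
  of the differences of the factors, and the i-th powers differ by at most \<open>\<alpha> i\<close>
  times \<delta>. This estimate carries bounds from the net to the whole ball.\<close>

lemma norm_mpower_diff_le:
  assumes "\<And>i. cmod (z $ i) \<le> 1" "\<And>i. cmod (w $ i) \<le> 1" "\<And>i. cmod (z $ i - w $ i) \<le> \<delta>"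
  shows "cmod (mpower z \<alpha> - mpower w \<alpha>) \<le> (\<Sum>i\<in>UNIV. real (\<alpha> i)) * \<delta>"
proof -
  have "cmod (mpower z \<alpha> - mpower w \<alpha>) \<le> (\<Sum>i\<in>UNIV. cmod ((z $ i) ^ \<alpha> i - (w $ i) ^ \<alpha> i))"
    unfolding mpower_def by (rule norm_prod_diff) (simp_all add: norm_power power_le_one assms)
  also have "\<dots> \<le> (\<Sum>i\<in>UNIV. real (\<alpha> i) * \<delta>)"
    by (intro sum_mono order_trans[OF norm_power_diff] mult_left_mono assms) auto
  finally show ?thesis by (simp add: sum_distrib_right)
qed

text \<open>The expansion of the m-th power of the sum of the coordinates, with the sign
  \<open>\<epsilon> \<alpha>\<close> attached to its term of index \<alpha>.\<close>

definition signed_form :: "nat \<Rightarrow> (('n \<Rightarrow> nat) \<Rightarrow> real) \<Rightarrow> complex ^ 'n::finite \<Rightarrow> complex" where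
  "signed_form m \<epsilon> z = (\<Sum>\<alpha>\<in>degree_indices m. of_real (\<epsilon> \<alpha>) * (of_nat (card (arrangements \<alpha>)) * mpower z \<alpha>))"

text \<open>This is the cardinality condition of \<open>exists_signs_sum_le\<close> for the grid
  with \<open>N = 2 * m * n ^ m\<close>. Because ln n \<le> m + 1, the base 2N + 1 is at most exp((m
  + 1)^2), so the logarithm of the whole count is of order n m^2.\<close>

lemma net_card_bound:
  fixes n m :: nat
  assumes "1 \<le> m" "2 \<le> n" "ln (real n) \<le> real m + 1"
  shows "4 * real ((2 * (2 * m * n ^ m) + 1) ^ (2 * n)) \<le> exp (9 * real n * (real m)\<^sup>2)"
proof -
  have pos: "0 < real n" "1 \<le> real m" using assms by simp_all
  have "real (2 * (2 * m * n ^ m) + 1) \<le> 5 * real m * real n ^ m"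
  proof -
    have "1 \<le> m * n ^ m" using assms by (simp add: Suc_le_eq)
    then have "2 * (2 * m * n ^ m) + 1 \<le> 5 * m * n ^ m" by linarith
    then have "real (2 * (2 * m * n ^ m) + 1) \<le> real (5 * m * n ^ m)" by (simp only: of_nat_le_iff)
    then show ?thesis by simp
  qed
  also have "\<dots> \<le> exp (real m + 1) * exp (real m * (real m + 1))"
  proof (intro mult_mono)
    \<comment> \<open>The bound 5 \<le> exp 2 comes from 1 + 2 + 2^2/2 = 5.\<close>
    have "5 * real m \<le> 5 * exp (real m - 1)" 
      using exp_ge_add_one_self[of "real m - 1"] by simp
    also have "\<dots> \<le> exp 2 * exp (real m - 1)"
      using exp_lower_Taylor_quadratic[of "2 :: real"] by (intro mult_right_mono) auto
    also have "\<dots> = exp (real m + 1)" by (simp flip: exp_add)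
    finally show "5 * real m \<le> exp (real m + 1)" .
    have "exp (ln (real n)) \<le> exp (real m + 1)" using assms(3) by (simp only: exp_le_cancel_iff)
    then have "real n \<le> exp (real m + 1)" using pos by simp
    then have "real n ^ m \<le> exp (real m + 1) ^ m" by (rule power_mono) simp
    then show "real n ^ m \<le> exp (real m * (real m + 1))" by (simp add: exp_of_nat_mult)
  qed auto
  also have "\<dots> = exp ((real m + 1)\<^sup>2)"
    by (simp add: power2_eq_square algebra_simps flip: exp_add)
  finally have "real (2 * (2 * m * n ^ m) + 1) ^ (2 * n) \<le> exp ((real m + 1)\<^sup>2) ^ (2 * n)"
    by (rule power_mono) simp
  also have "\<dots> = exp (2 * real n * (real m + 1)\<^sup>2)"
    by (simp flip: exp_of_nat_mult)
  finally have "real ((2 * (2 * m * n ^ m) + 1) ^ (2 * n)) \<le> exp (2 * real n * (real m + 1)\<^sup>2)"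
    by simp
  moreover have "4 \<le> exp (real n)"
  proof -
    have "4 \<le> exp (2 :: real)" using exp_lower_Taylor_quadratic[of "2 :: real"] by simp
    also have "\<dots> \<le> exp (real n)" using assms by simp
    finally show ?thesis .
  qed
  ultimately have "4 * real ((2 * (2 * m * n ^ m) + 1) ^ (2 * n)) \<le> exp (real n) * exp (2 * real n * (real m + 1)\<^sup>2)"
    by (intro mult_mono) auto
  also have "\<dots> = exp (real n * (1 + 2 * (real m + 1)\<^sup>2))"
    by (simp add: algebra_simps flip: exp_add)
  also have "\<dots> \<le> exp (real n * (9 * (real m)\<^sup>2))"
  proof -
    have "1 \<le> (real m)\<^sup>2" using pos by simp
    moreover have "(real m + 1)\<^sup>2 \<le> (2 * real m)\<^sup>2" using pos by (intro power_mono) auto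
    ultimately have "1 + 2 * (real m + 1)\<^sup>2 \<le> 9 * (real m)\<^sup>2" by (simp add: power2_eq_square)
    then show ?thesis using pos by simp
  qed
  finally show ?thesis by (simp add: mult_ac)
qed

text \<open>On a net the signs are chosen with variance bound m! and H = 9 n m^2, which yields the
  factor 2 * 3 = 6. Passing from the net to an arbitrary point costs at most 1, and this raises the
  factor to 7.\<close>

lemma exists_signs_form_le:
  assumes "1 \<le> m" "2 \<le> CARD('n::finite)" "ln (real CARD('n)) \<le> real m + 1"
  shows "\<exists>\<epsilon>. (\<forall>\<alpha>. \<epsilon> \<alpha> \<in> {1, -1}) \<and> (\<forall>z :: complex ^ 'n. (\<Sum>i\<in>UNIV. (cmod (z $ i))\<^sup>2) \<le> 1 \<longrightarrow>
     cmod (signed_form m \<epsilon> z) \<le> 7 * sqrt (fact m) * real m * sqrt (real CARD('n)))"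
proof -
  define n where "n = CARD('n)"
  define A where "A = (degree_indices m :: ('n \<Rightarrow> nat) set)"
  \<comment> \<open>The mesh is chosen so that the total error is exactly 1: the coefficients sum to
    n^m and each monomial changes by at most m * 2/N.\<close>
  define N where "N = 2 * m * n ^ m"
  have n: "0 < n" "2 \<le> n" using assms by (auto simp: n_def)
  have "0 < N" using assms n by (simp add: N_def)
  then obtain G :: "(complex ^ 'n) set" where "finite G" and cardG: "card G \<le> (2 * N + 1) ^ (2 * n)"
    and G: "\<And>w. w \<in> G \<Longrightarrow> (\<Sum>i\<in>UNIV. (cmod (w $ i))\<^sup>2) \<le> 1"
    and net: "\<And>z. (\<Sum>i\<in>UNIV. (cmod (z $ i))\<^sup>2) \<le> 1 \<Longrightarrow> \<exists>w\<in>G. \<forall>i. cmod (z $ i - w $ i) \<le> 2 / real N"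
    using exists_grid_net[of N, where 'n = 'n] unfolding n_def by auto
  \<comment> \<open>Of the two multinomial coefficients in each square, one is bounded by m!; the
    other is kept, so that the multinomial theorem sums the rest to a power of the squared Euclidean
    norm.\<close>
  have var: "(\<Sum>\<alpha>\<in>A. (cmod (of_nat (card (arrangements \<alpha>)) * mpower w \<alpha>))\<^sup>2) \<le> (sqrt (fact m))\<^sup>2"
    if "w \<in> G" for w
  proof -
    have "(\<Sum>\<alpha>\<in>A. (cmod (of_nat (card (arrangements \<alpha>)) * mpower w \<alpha>))\<^sup>2)
        \<le> (\<Sum>\<alpha>\<in>A. fact m * (of_nat (card (arrangements \<alpha>)) * (\<Prod>i\<in>UNIV. ((cmod (w $ i))\<^sup>2) ^ \<alpha> i)))"
    proof (intro sum_mono)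
      fix \<alpha> assume "\<alpha> \<in> A"
      then have "card (arrangements \<alpha>) \<le> fact m" unfolding A_def by (rule card_arrangements_le)
      then have "real (card (arrangements \<alpha>)) \<le> real (fact m)" by (simp only: of_nat_le_iff)
      then have "real (card (arrangements \<alpha>)) \<le> fact m" by simp
      then have "real (card (arrangements \<alpha>)) * (real (card (arrangements \<alpha>)) * (cmod (mpower w \<alpha>))\<^sup>2)
          \<le> fact m * (real (card (arrangements \<alpha>)) * (cmod (mpower w \<alpha>))\<^sup>2)"
        by (intro mult_right_mono) auto
      moreover have "(cmod (mpower w \<alpha>))\<^sup>2 = (\<Prod>i\<in>UNIV. ((cmod (w $ i))\<^sup>2) ^ \<alpha> i)"
        by (simp add: norm_mpower prod_power_distrib mult.commute flip: power_mult)
      ultimately show "(cmod (of_nat (card (arrangements \<alpha>)) * mpower w \<alpha>))\<^sup>2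
          \<le> fact m * (of_nat (card (arrangements \<alpha>)) * (\<Prod>i\<in>UNIV. ((cmod (w $ i))\<^sup>2) ^ \<alpha> i))"
        by (simp add: norm_mult power_mult_distrib power2_eq_square[of "real _"] mult.assoc)
    qed
    also have "\<dots> = fact m * (\<Sum>i\<in>UNIV. (cmod (w $ i))\<^sup>2) ^ m"
      unfolding A_def by (simp add: sum_distrib_left[symmetric] multinomial_expansion)
    also have "\<dots> \<le> fact m * 1"
      using G[OF that] by (intro mult_left_mono power_le_one sum_nonneg) auto
    finally show ?thesis by simp
  qed
  have "4 * real (card G) \<le> 4 * real ((2 * N + 1) ^ (2 * n))"
    using cardG by (simp only: of_nat_le_iff mult_le_cancel_left_pos zero_less_numeral)
  also have "\<dots> \<le> exp (9 * real n * (real m)\<^sup>2)"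
    unfolding N_def using assms n by (intro net_card_bound) (auto simp: n_def)
  finally have card: "4 * real (card G) \<le> exp (9 * real n * (real m)\<^sup>2)" .
  have "\<exists>\<epsilon>. (\<forall>\<alpha>. \<epsilon> \<alpha> \<in> {1, -1 :: real}) \<and>
      (\<forall>w\<in>G. cmod (signed_form m \<epsilon> w) \<le> 2 * sqrt (9 * real n * (real m)\<^sup>2) * sqrt (fact m))"
    unfolding signed_form_def A_def[symmetric]
  proof (rule exists_signs_sum_le[OF _ \<open>finite G\<close> _ _ var card])
    show "finite A" unfolding A_def by (rule finite_degree_indices)
    show "0 < 9 * real n * (real m)\<^sup>2" using assms n by simp
  qed simp_all
  then obtain \<epsilon> where \<epsilon>: "\<forall>\<alpha>. \<epsilon> \<alpha> \<in> {1, -1 :: real}"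
    and onG: "\<forall>w\<in>G. cmod (signed_form m \<epsilon> w) \<le> 2 * sqrt (9 * real n * (real m)\<^sup>2) * sqrt (fact m)"
    by blast
  have "cmod (signed_form m \<epsilon> z) \<le> 7 * sqrt (fact m) * real m * sqrt (real n)"
    if z: "(\<Sum>i\<in>UNIV. (cmod (z $ i))\<^sup>2) \<le> 1" for z
  proof -
    obtain w where w: "w \<in> G" "\<And>i. cmod (z $ i - w $ i) \<le> 2 / real N" using net[OF z] by blast
    have "cmod (signed_form m \<epsilon> z - signed_form m \<epsilon> w)
        \<le> (\<Sum>\<alpha>\<in>A. cmod (of_real (\<epsilon> \<alpha>) * (of_nat (card (arrangements \<alpha>)) * (mpower z \<alpha> - mpower w \<alpha>))))"
      unfolding signed_form_def A_def sum_subtractf[symmetric] right_diff_distrib[symmetric] by (rule norm_sum)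
    also have "\<dots> \<le> (\<Sum>\<alpha>\<in>A. real (card (arrangements \<alpha>)) * (real m * (2 / real N)))"
    proof (intro sum_mono)
      fix \<alpha> assume "\<alpha> \<in> A"
      then have "(\<Sum>i\<in>UNIV. real (\<alpha> i)) = real m"
        unfolding A_def using sum_degree_indices[of \<alpha> m] by (simp flip: of_nat_sum)
      then have "cmod (mpower z \<alpha> - mpower w \<alpha>) \<le> real m * (2 / real N)"
        using norm_mpower_diff_le[of z w "2 / real N" \<alpha>] w
          norm_coord_le_one[OF z] norm_coord_le_one[OF G[OF w(1)]] by simp
      moreover have "\<bar>\<epsilon> \<alpha>\<bar> = 1" using \<epsilon>[rule_format, of \<alpha>] by auto
      ultimately show "cmod (of_real (\<epsilon> \<alpha>) * (of_nat (card (arrangements \<alpha>)) * (mpower z \<alpha> - mpower w \<alpha>)))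
          \<le> real (card (arrangements \<alpha>)) * (real m * (2 / real N))"
        by (simp only: norm_mult norm_of_real norm_of_nat mult_1_left) (rule mult_left_mono, simp_all)
    qed
    also have "\<dots> = real (n ^ m) * (real m * (2 / real N))"
      unfolding A_def n_def
      by (simp only: sum_distrib_right[symmetric] of_nat_sum[symmetric] sum_card_arrangements)
    also have "\<dots> = 1" using assms n by (simp add: N_def)
    finally have "cmod (signed_form m \<epsilon> z - signed_form m \<epsilon> w) \<le> 1" .
    then have "cmod (signed_form m \<epsilon> z) \<le> 1 + cmod (signed_form m \<epsilon> w)"
      using norm_triangle_ineq2[of "signed_form m \<epsilon> z" "signed_form m \<epsilon> w"] by linarith
    also have "cmod (signed_form m \<epsilon> w) \<le> 6 * (sqrt (fact m) * real m * sqrt (real n))"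
    proof -
      have "sqrt (9 * real n * (real m)\<^sup>2) = 3 * sqrt (real n) * real m"
        by (simp add: real_sqrt_mult real_sqrt_eq_iff)
      then show ?thesis using onG w(1) by (simp add: mult_ac)
    qed
    \<comment> \<open>The additive 1 is absorbed as a seventh copy of the main term.\<close>
    also have "1 \<le> sqrt (fact m) * real m * sqrt (real n)"
    proof -
      have "1 \<le> sqrt (fact m)" "1 \<le> real m" "1 \<le> sqrt (real n)"
        using assms n by (auto simp: fact_ge_1)
      then have "1 * 1 * 1 \<le> sqrt (fact m) * real m * sqrt (real n)"
        by (intro mult_mono) auto
      then show ?thesis by simp
    qed
    finally show ?thesis by (simp add: mult_ac)
  qed
  with \<epsilon> show ?thesis unfolding n_def by blast
qed

section \<open>Holomorphic maps and Bohr radii\<close>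

lemma bounded_linear_scaleC_left: "bounded_linear (\<lambda>c. c *\<^sub>C (x :: 'x::complex_banach))"
proof (rule bounded_linear_intro)
  show "norm (c *\<^sub>C x) \<le> norm c * norm x" for c by (simp add: norm_scaleC)
qed (simp_all add: scaleC_add_left scaleR_scaleC scaleC_scaleC scaleC_complex_def)

lemma scaleC_zero_right: "c *\<^sub>C (0 :: 'x::complex_banach) = 0"
  by (metis mult_zero_right norm_eq_zero norm_scaleC)

lemma holomorphic_vec_const: "holomorphic_vec_on (\<lambda>z. c :: complex) \<Omega>"
  unfolding holomorphic_vec_on_def
  by (intro ballI exI[of _ "\<lambda>_. 0"]) (simp add: scaleC_complex_def)

lemma holomorphic_vec_coord: "holomorphic_vec_on (\<lambda>z. z $ i) \<Omega>"
  unfolding holomorphic_vec_on_def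
  by (intro ballI exI[of _ "\<lambda>z. z $ i"] conjI bounded_linear_imp_has_derivative bounded_linear_vec_nth)
     (simp add: scaleC_complex_def)

lemma holomorphic_vec_add:
  fixes f g :: "complex ^ 'n::finite \<Rightarrow> complex"
  assumes "holomorphic_vec_on f \<Omega>" "holomorphic_vec_on g \<Omega>"
  shows "holomorphic_vec_on (\<lambda>z. f z + g z) \<Omega>"
  unfolding holomorphic_vec_on_def
proof
  fix z assume "z \<in> \<Omega>"
  with assms obtain D E where
    "(f has_derivative D) (at z)" "\<forall>c v. D (c *s v) = c *\<^sub>C D v"
    "(g has_derivative E) (at z)" "\<forall>c v. E (c *s v) = c *\<^sub>C E v"
    unfolding holomorphic_vec_on_def by blast
  then show "\<exists>D. ((\<lambda>z. f z + g z) has_derivative D) (at z) \<and> (\<forall>c v. D (c *s v) = c *\<^sub>C D v)"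
    by (intro exI[of _ "\<lambda>v. D v + E v"]) (simp add: has_derivative_add scaleC_complex_def distrib_left)
qed

lemma holomorphic_vec_mult:
  fixes f g :: "complex ^ 'n::finite \<Rightarrow> complex"
  assumes "holomorphic_vec_on f \<Omega>" "holomorphic_vec_on g \<Omega>"
  shows "holomorphic_vec_on (\<lambda>z. f z * g z) \<Omega>"
  unfolding holomorphic_vec_on_def
proof
  fix z assume "z \<in> \<Omega>"
  with assms obtain D E where
    "(f has_derivative D) (at z)" "\<forall>c v. D (c *s v) = c *\<^sub>C D v"
    "(g has_derivative E) (at z)" "\<forall>c v. E (c *s v) = c *\<^sub>C E v"
    unfolding holomorphic_vec_on_def by blast
  then show "\<exists>D. ((\<lambda>z. f z * g z) has_derivative D) (at z) \<and> (\<forall>c v. D (c *s v) = c *\<^sub>C D v)"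
    by (intro exI[of _ "\<lambda>v. f z * E v + D v * g z"] conjI has_derivative_mult)
       (simp_all add: scaleC_complex_def distrib_left mult_ac)
qed

lemma holomorphic_vec_sum:
  fixes f :: "'a \<Rightarrow> complex ^ 'n::finite \<Rightarrow> complex"
  assumes "\<And>a. a \<in> A \<Longrightarrow> holomorphic_vec_on (f a) \<Omega>"
  shows "holomorphic_vec_on (\<lambda>z. \<Sum>a\<in>A. f a z) \<Omega>"
  using assms
  by (induction A rule: infinite_finite_induct) (simp_all add: holomorphic_vec_const holomorphic_vec_add)

lemma holomorphic_vec_prod:
  fixes f :: "'a \<Rightarrow> complex ^ 'n::finite \<Rightarrow> complex"
  assumes "\<And>a. a \<in> A \<Longrightarrow> holomorphic_vec_on (f a) \<Omega>"
  shows "holomorphic_vec_on (\<lambda>z. \<Prod>a\<in>A. f a z) \<Omega>"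
  using assms
  by (induction A rule: infinite_finite_induct) (simp_all add: holomorphic_vec_const holomorphic_vec_mult)

lemma holomorphic_vec_power:
  fixes f :: "complex ^ 'n::finite \<Rightarrow> complex"
  assumes "holomorphic_vec_on f \<Omega>"
  shows "holomorphic_vec_on (\<lambda>z. f z ^ k) \<Omega>"
  using assms by (induction k) (simp_all add: holomorphic_vec_const holomorphic_vec_mult)

lemma holomorphic_signed_form: "holomorphic_vec_on (signed_form m \<epsilon>) \<Omega>"
  unfolding signed_form_def mpower_def
  by (intro holomorphic_vec_sum holomorphic_vec_mult holomorphic_vec_const holomorphic_vec_prod
      holomorphic_vec_power holomorphic_vec_coord)

text \<open>The line spanned by \<open>x\<close> serves as the copy of the scalars in the target
  space; scalar test functions are moved there by a bounded complex linear map, which is composed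
  with the derivative.\<close>

lemma holomorphic_vec_scaleC:
  fixes f :: "complex ^ 'n::finite \<Rightarrow> complex" and x :: "'x::complex_banach"
  assumes "holomorphic_vec_on f \<Omega>"
  shows "holomorphic_vec_on (\<lambda>z. f z *\<^sub>C x) \<Omega>"
  unfolding holomorphic_vec_on_def
proof
  fix z assume "z \<in> \<Omega>"
  with assms obtain D where
    "(f has_derivative D) (at z)" "\<forall>c v. D (c *s v) = c *\<^sub>C D v"
    unfolding holomorphic_vec_on_def by blast
  then show "\<exists>D. ((\<lambda>z. f z *\<^sub>C x) has_derivative D) (at z) \<and> (\<forall>c v. D (c *s v) = c *\<^sub>C D v)"
    by (intro exI[of _ "\<lambda>v. D v *\<^sub>C x"])
       (simp add: bounded_linear.has_derivative[OF bounded_linear_scaleC_left] scaleC_complex_def scaleC_scaleC)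
qed

text \<open>The coefficients vanish outside degree m, so the series is a finite sum and represents
  the function at every point, whatever the domain.\<close>

lemma power_series_signed_form:
  fixes x :: "'x::complex_banach" and \<Omega> :: "(complex ^ 'n::finite) set"
  shows "power_series_expansion_on (\<lambda>z. signed_form m \<epsilon> z *\<^sub>C x)
    (\<lambda>\<alpha>. if \<alpha> \<in> degree_indices m then (of_real (\<epsilon> \<alpha>) * of_nat (card (arrangements \<alpha>))) *\<^sub>C x else 0) \<Omega>"
  unfolding power_series_expansion_on_def
proof
  fix z :: "complex ^ 'n"
  interpret bounded_linear "\<lambda>c. c *\<^sub>C x" by (rule bounded_linear_scaleC_left)
  have "((\<lambda>\<alpha>. (of_real (\<epsilon> \<alpha>) * (of_nat (card (arrangements \<alpha>)) * mpower z \<alpha>)) *\<^sub>C x)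
      has_sum signed_form m \<epsilon> z *\<^sub>C x) (degree_indices m)"
    unfolding signed_form_def sum by (rule has_sum_finite) (rule finite_degree_indices)
  then show "((\<lambda>\<alpha>. mpower z \<alpha> *\<^sub>C (if \<alpha> \<in> degree_indices m
      then (of_real (\<epsilon> \<alpha>) * of_nat (card (arrangements \<alpha>))) *\<^sub>C x else 0)) has_sum signed_form m \<epsilon> z *\<^sub>C x) UNIV"
    by (rule has_sum_cong_neutral[THEN iffD1, rotated -1])
       (auto simp: scaleC_scaleC scaleC_zero_right mult_ac)
qed

section \<open>Comparison of the l_p ball with the Euclidean ball\<close>

text \<open>Young's inequality for the product of u and 1 with conjugate exponents q and q/(q - 1);
  the case q = 1, where there is no finite conjugate exponent, is trivial.\<close>

lemma le_powr_div_add: "u \<le> u powr q / q + (1 - 1 / q)" if "0 \<le> u" "1 \<le> q" for u q :: real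
proof (cases "q = 1")
  case False
  then have "u * 1 \<le> u powr q / q + 1 powr (q / (q - 1)) / (q / (q - 1))"
    using that by (intro Youngs_inequality) (auto simp: field_simps)
  also have "1 powr (q / (q - 1)) / (q / (q - 1)) = 1 - 1 / q"
    using that False by (simp add: field_simps)
  finally show ?thesis by simp
qed (use that in simp)

lemma lp_ball_iff:
  fixes z :: "complex ^ 'n::finite"
  assumes "1 \<le> p"
  shows "z \<in> lp_ball p \<longleftrightarrow> (\<Sum>i\<in>UNIV. cmod (z $ i) powr p) < 1"
proof -
  define S where "S = (\<Sum>i\<in>UNIV. cmod (z $ i) powr p)"
  have "0 \<le> S" unfolding S_def by (intro sum_nonneg) auto
  then have "S powr (1 / p) < 1" if "S < 1"
    using powr_less_mono2[of "1 / p" S 1] that assms by simp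
  moreover have "1 \<le> S powr (1 / p)" if "1 \<le> S"
    using that assms by (intro ge_one_powr_ge_zero) auto
  ultimately show ?thesis by (force simp: lp_ball_def lp_norm_def S_def)
qed

lemma lp_ball_coord_le:
  fixes z :: "complex ^ 'n::finite"
  assumes "1 \<le> p" "z \<in> lp_ball p"
  shows "cmod (z $ i) \<le> 1"
proof (rule ccontr)
  assume "\<not> ?thesis"
  then have "1 \<le> cmod (z $ i) powr p" using assms by (intro ge_one_powr_ge_zero) auto
  also have "\<dots> \<le> (\<Sum>i\<in>UNIV. cmod (z $ i) powr p)" by (rule member_le_sum) auto
  finally show False using assms lp_ball_iff by force
qed

text \<open>For p \<le> 2 the coordinates have modulus at most 1, so squares are at most p-th
  powers. For p > 2 this is Hoelder's inequality with exponent p/2, obtained by summing Young's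
  inequality over the coordinates.\<close>

lemma lp_ball_sum_squares_le:
  fixes z :: "complex ^ 'n::finite"
  assumes "1 \<le> p" "z \<in> lp_ball p"
  shows "(\<Sum>i\<in>UNIV. (cmod (z $ i))\<^sup>2) \<le> (real CARD('n) powr max 0 (1 / 2 - 1 / p))\<^sup>2"
proof (cases "p \<le> 2")
  case True
  have "(\<Sum>i\<in>UNIV. (cmod (z $ i))\<^sup>2) \<le> (\<Sum>i\<in>UNIV. cmod (z $ i) powr p)"
  proof (rule sum_mono)
    fix i
    have "cmod (z $ i) powr 2 \<le> cmod (z $ i) powr p"
      using lp_ball_coord_le[OF assms, of i] True by (intro powr_mono') auto
    then show "(cmod (z $ i))\<^sup>2 \<le> cmod (z $ i) powr p" by simp
  qed
  then show ?thesis using assms True lp_ball_iff[OF assms(1), of z] by (simp add: max_def field_simps)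
next
  case False
  define n where "n = real CARD('n)"
  define q where "q = p / 2"
  have n: "1 \<le> n" by (simp add: n_def Suc_le_eq)
  have q: "1 \<le> q" using False by (simp add: q_def)
  \<comment> \<open>The weight n^(1/q) normalizes the terms: the q-th powers then sum to at most n,
    and the two parts n/q and n(1 - 1/q) add up to n.\<close>
  have "(\<Sum>i\<in>UNIV. n powr (1 / q) * (cmod (z $ i))\<^sup>2)
      \<le> (\<Sum>i\<in>UNIV. (n * cmod (z $ i) powr p) / q + (1 - 1 / q))"
  proof (rule sum_mono)
    fix i
    have "(n powr (1 / q) * (cmod (z $ i))\<^sup>2) powr q = n * cmod (z $ i) powr p"
    proof -
      have "(n powr (1 / q) * (cmod (z $ i))\<^sup>2) powr q = (n powr (1 / q) * cmod (z $ i) powr 2) powr q" by simp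
      also have "\<dots> = n * cmod (z $ i) powr p"
        unfolding powr_mult powr_powr using q n by (simp add: q_def)
      finally show ?thesis .
    qed
    with le_powr_div_add[of "n powr (1 / q) * (cmod (z $ i))\<^sup>2" q] q
    show "n powr (1 / q) * (cmod (z $ i))\<^sup>2 \<le> (n * cmod (z $ i) powr p) / q + (1 - 1 / q)" by simp
  qed
  also have "\<dots> = n * (\<Sum>i\<in>UNIV. cmod (z $ i) powr p) / q + n * (1 - 1 / q)"
    by (simp add: sum.distrib n_def sum_distrib_left flip: sum_divide_distrib)
  also have "\<dots> \<le> n * 1 / q + n * (1 - 1 / q)"
    using assms lp_ball_iff[OF assms(1), of z] n q by (intro add_right_mono divide_right_mono mult_left_mono) auto
  also have "\<dots> = n" using q by (simp add: field_simps)
  finally have "n powr (1 / q) * (\<Sum>i\<in>UNIV. (cmod (z $ i))\<^sup>2) \<le> n"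
    by (simp add: sum_distrib_left)
  then have "(\<Sum>i\<in>UNIV. (cmod (z $ i))\<^sup>2) \<le> n / n powr (1 / q)"
    using n by (simp add: pos_le_divide_eq mult.commute)
  also have "\<dots> = n powr (1 - 1 / q)" using n by (simp add: powr_diff)
  also have "1 - 1 / q = (1 / 2 - 1 / p) + (1 / 2 - 1 / p)" by (simp add: q_def)
  also have "n powr \<dots> = (n powr (1 / 2 - 1 / p))\<^sup>2" unfolding powr_add power2_eq_square ..
  also have "1 / 2 - 1 / p = max 0 (1 / 2 - 1 / p)" using False by (simp add: field_simps)
  finally show ?thesis by (simp add: n_def)
qed

section \<open>Existence of the largest admissible radius\<close>

text \<open>Monomials are homogeneous, so r enters only through a power. Finite partial sums of the
  Bohr series therefore depend polynomially on r.\<close>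

lemma SUP_scaled_domain:
  fixes a :: "'x::complex_banach" and \<Omega> :: "(complex ^ 'n::finite) set"
  assumes "0 \<le> r"
  shows "(SUP z\<in>(\<lambda>z. r *\<^sub>R z) ` \<Omega>. ennreal (norm (mpower z \<alpha> *\<^sub>C a)))
    = ennreal (r ^ (\<Sum>i\<in>UNIV. \<alpha> i)) * (SUP z\<in>\<Omega>. ennreal (norm (mpower z \<alpha> *\<^sub>C a)))"
  unfolding SUP_mult_left_ennreal image_image mpower_scaleR
  using assms by (simp add: norm_scaleC norm_mult norm_power mult.assoc flip: ennreal_mult)

lemma infsum_ennreal_le_iff: "infsum f UNIV \<le> (C :: ennreal) \<longleftrightarrow> (\<forall>F. finite F \<longrightarrow> sum f F \<le> C)"
  by (simp add: nonneg_infsum_complete SUP_le_iff)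

text \<open>At r = 0 only the constant term survives; it equals f(0), whose norm is at most the
  supremum, and L \<ge> 1. Hence the set of admissible radii is nonempty.\<close>

lemma bohr_inequality_zero:
  fixes \<Omega> :: "(complex ^ 'n::finite) set"
  assumes "0 \<in> \<Omega>" "1 \<le> L"
  shows "bohr_inequality TYPE('x::complex_banach) \<Omega> L 0"
  unfolding bohr_inequality_def
proof (intro allI impI, elim conjE)
  fix f :: "complex ^ 'n \<Rightarrow> 'x" and a
  assume "power_series_expansion_on f a \<Omega>"
  then have sum0: "((\<lambda>\<alpha>. mpower 0 \<alpha> *\<^sub>C a \<alpha>) has_sum f 0) UNIV"
    using assms by (auto simp: power_series_expansion_on_def)
  define o0 :: "'n \<Rightarrow> nat" where "o0 = (\<lambda>_. 0)"
  \<comment> \<open>Since 0^0 = 1, the monomial with all exponents zero has value 1 at the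
    origin.\<close>
  have mp0: "mpower 0 \<alpha> = (if \<alpha> = o0 then 1 else 0)" for \<alpha> :: "'n \<Rightarrow> nat"
    by (auto simp: mpower_def o0_def fun_eq_iff)
  have zero: "(0 :: complex) *\<^sub>C y = 0" for y :: 'x
    using norm_scaleC[of 0 y] by simp
  have "((\<lambda>\<alpha>. mpower 0 \<alpha> *\<^sub>C a \<alpha>) has_sum a o0) {o0}"
    by (rule has_sum_finiteI) (simp_all add: mp0 scaleC_one)
  then have "((\<lambda>\<alpha>. mpower 0 \<alpha> *\<^sub>C a \<alpha>) has_sum a o0) UNIV"
    by (rule has_sum_cong_neutral[THEN iffD1, rotated -1]) (auto simp: mp0 zero)
  with sum0 have f0: "f 0 = a o0" by (rule has_sum_unique)
  have "(SUP z\<in>(\<lambda>z. 0 *\<^sub>R z) ` \<Omega>. ennreal (norm (mpower z \<alpha> *\<^sub>C a \<alpha>)))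
      = (if \<alpha> = o0 then ennreal (norm (f 0)) else 0)" for \<alpha>
  proof -
    have "(\<lambda>z. 0 *\<^sub>R z) ` \<Omega> = {0}" using assms by auto
    then show ?thesis by (simp add: mp0 zero scaleC_one f0)
  qed
  then have "(\<Sum>\<^sub>\<infinity>\<alpha>. SUP z\<in>(\<lambda>z. 0 *\<^sub>R z) ` \<Omega>. ennreal (norm (mpower z \<alpha> *\<^sub>C a \<alpha>)))
      = (\<Sum>\<^sub>\<infinity>\<alpha>. if \<alpha> = o0 then ennreal (norm (f 0)) else 0)" by simp
  also have "\<dots> = (\<Sum>\<^sub>\<infinity>\<alpha>\<in>{o0}. ennreal (norm (f 0)))"
    by (rule infsum_cong_neutral) auto
  also have "\<dots> = ennreal 1 * ennreal (norm (f 0))" by simp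
  also have "\<dots> \<le> ennreal L * (SUP z\<in>\<Omega>. ennreal (norm (f z)))"
    using assms by (intro mult_mono SUP_upper ennreal_leI) auto
  finally show "(\<Sum>\<^sub>\<infinity>\<alpha>. SUP z\<in>(\<lambda>z. 0 *\<^sub>R z) ` \<Omega>. ennreal (norm (mpower z \<alpha> *\<^sub>C a \<alpha>)))
      \<le> ennreal L * (SUP z\<in>\<Omega>. ennreal (norm (f z)))" .
qed

text \<open>A bound on every admissible r says something about the \<open>GREATEST\<close> value
  only once a greatest one exists. It does: the supremum of the admissible radii is itself
  admissible, because each inequality for a finite partial sum is a closed condition on r.\<close>

lemma bohr_radius_le:
  fixes \<Omega> :: "(complex ^ 'n::finite) set"
  assumes "0 \<in> \<Omega>" and coord: "\<And>z i. z \<in> \<Omega> \<Longrightarrow> cmod (z $ i) \<le> 1" and "1 \<le> L"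
    and bound: "\<And>r. 0 \<le> r \<Longrightarrow> bohr_inequality TYPE('x::complex_banach) \<Omega> L r \<Longrightarrow> r \<le> B"
  shows "bohr_radius \<Omega> TYPE('x) L \<le> B"
proof -
  define S where "S = {r. 0 \<le> r \<and> bohr_inequality TYPE('x) \<Omega> L r}"
  define s where "s = Sup S"
  have "0 \<in> S" using assms by (simp add: S_def bohr_inequality_zero)
  have bdd: "bdd_above S" using bound by (auto simp: S_def bdd_above_def)
  have upper: "r \<le> s" if "r \<in> S" for r unfolding s_def using that bdd by (rule cSup_upper)
  have s0: "0 \<le> s" using upper[OF \<open>0 \<in> S\<close>] .
  have s_clos: "s \<in> closure S"
    unfolding s_def using \<open>0 \<in> S\<close> bdd by (intro closure_contains_Sup) auto
  have "bohr_inequality TYPE('x) \<Omega> L s"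
    unfolding bohr_inequality_def infsum_ennreal_le_iff
  proof (intro allI impI, elim conjE)
    fix f :: "complex ^ 'n \<Rightarrow> 'x" and a and F :: "('n \<Rightarrow> nat) set"
    assume f: "holomorphic_vec_on f \<Omega>" "bounded (f ` \<Omega>)" "power_series_expansion_on f a \<Omega>"
      and "finite F"
    define C where "C = ennreal L * (SUP z\<in>\<Omega>. ennreal (norm (f z)))"
    \<comment> \<open>The supremum over \<Omega> as a real number; it is finite because coordinates
      have modulus at most 1 on \<Omega>.\<close>
    define k where "k \<alpha> = enn2real (SUP z\<in>\<Omega>. ennreal (norm (mpower z \<alpha> *\<^sub>C a \<alpha>)))" for \<alpha>
    have k: "(SUP z\<in>\<Omega>. ennreal (norm (mpower z \<alpha> *\<^sub>C a \<alpha>))) = ennreal (k \<alpha>)" for \<alpha>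
    proof -
      have "(SUP z\<in>\<Omega>. ennreal (norm (mpower z \<alpha> *\<^sub>C a \<alpha>))) \<le> ennreal (norm (a \<alpha>))"
      proof (intro SUP_least ennreal_leI)
        fix z assume "z \<in> \<Omega>"
        then have "cmod (mpower z \<alpha>) \<le> 1"
          unfolding norm_mpower by (intro prod_le_1) (simp add: coord power_le_one)
        then show "norm (mpower z \<alpha> *\<^sub>C a \<alpha>) \<le> norm (a \<alpha>)"
          by (simp add: norm_scaleC mult_left_le_one_le)
      qed
      then have "(SUP z\<in>\<Omega>. ennreal (norm (mpower z \<alpha> *\<^sub>C a \<alpha>))) < top"
        by (rule le_less_trans) simp
      then show ?thesis unfolding k_def by (simp only: ennreal_enn2real)
    qed
    have sum_eq: "(\<Sum>\<alpha>\<in>F. SUP z\<in>(\<lambda>z. r *\<^sub>R z) ` \<Omega>. ennreal (norm (mpower z \<alpha> *\<^sub>C a \<alpha>)))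
        = ennreal (\<Sum>\<alpha>\<in>F. r ^ (\<Sum>i\<in>UNIV. \<alpha> i) * k \<alpha>)" if "0 \<le> r" for r
    proof -
      have "0 \<le> k \<alpha>" for \<alpha> unfolding k_def by (rule enn2real_nonneg)
      then show ?thesis
        using that by (simp add: SUP_scaled_domain k flip: ennreal_mult)
    qed
    show "(\<Sum>\<alpha>\<in>F. SUP z\<in>(\<lambda>z. s *\<^sub>R z) ` \<Omega>. ennreal (norm (mpower z \<alpha> *\<^sub>C a \<alpha>)))
        \<le> ennreal L * (SUP z\<in>\<Omega>. ennreal (norm (f z)))"
    proof (cases "C = top")
      case False
      then obtain c where c: "0 \<le> c" "C = ennreal c" by (cases C) auto
      \<comment> \<open>For fixed \<open>f\<close> and \<open>F\<close> the condition on r is a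
        polynomial inequality, so it defines a closed set; it contains \<open>S\<close> and hence
        also \<open>s\<close>, which lies in the closure of \<open>S\<close>.\<close>
      have "S \<subseteq> {r. (\<Sum>\<alpha>\<in>F. r ^ (\<Sum>i\<in>UNIV. \<alpha> i) * k \<alpha>) \<le> c}"
      proof
        fix r assume "r \<in> S"
        then have r: "0 \<le> r" "bohr_inequality TYPE('x) \<Omega> L r" by (auto simp: S_def)
        then have "(\<Sum>\<alpha>\<in>F. SUP z\<in>(\<lambda>z. r *\<^sub>R z) ` \<Omega>. ennreal (norm (mpower z \<alpha> *\<^sub>C a \<alpha>))) \<le> C"
          using f \<open>finite F\<close> unfolding bohr_inequality_def infsum_ennreal_le_iff C_def by blast
        then show "r \<in> {r. (\<Sum>\<alpha>\<in>F. r ^ (\<Sum>i\<in>UNIV. \<alpha> i) * k \<alpha>) \<le> c}"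
          using r c by (simp add: sum_eq)
      qed
      moreover have "closed {r. (\<Sum>\<alpha>\<in>F. r ^ (\<Sum>i\<in>UNIV. \<alpha> i) * k \<alpha>) \<le> c}"
        by (intro closed_Collect_le continuous_intros)
      ultimately have "s \<in> {r. (\<Sum>\<alpha>\<in>F. r ^ (\<Sum>i\<in>UNIV. \<alpha> i) * k \<alpha>) \<le> c}"
        using s_clos closure_minimal by blast
      then show ?thesis using s0 c by (simp add: sum_eq C_def[symmetric] ennreal_leI)
    qed (simp add: C_def)
  qed
  then have "bohr_radius \<Omega> TYPE('x) L = s"
    unfolding bohr_radius_def using s0 upper by (intro Greatest_equality) (auto simp: S_def)
  also have "s \<le> B"
    unfolding s_def using \<open>0 \<in> S\<close> bound by (intro cSup_least) (auto simp: S_def)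
  finally show ?thesis .
qed

section \<open>The upper bound\<close>

text \<open>The Bohr inequality is tested on the signed polynomial times \<open>x\<close>. Each
  monomial of degree m is evaluated at a point of the ball where it has modulus \<mu>^(-m/p), and
  the multinomial coefficients sum to the m-th power of the dimension; the right-hand side is at
  most \<open>L * K * norm x\<close>.\<close>

lemma bohr_coefficient_bound:
  fixes x :: "'x::complex_banach" and \<epsilon> :: "('n::finite \<Rightarrow> nat) \<Rightarrow> real"
  assumes "x \<noteq> 0" "1 \<le> p" "0 \<le> L" "0 \<le> r" "0 \<le> K" "real m < \<mu>"
    and bohr: "bohr_inequality TYPE('x) (lp_ball p :: (complex ^ 'n) set) L r"
    and \<epsilon>: "\<And>\<alpha>. \<bar>\<epsilon> \<alpha>\<bar> = 1"
    and K: "\<And>z. z \<in> lp_ball p \<Longrightarrow> cmod (signed_form m \<epsilon> z) \<le> K"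
  shows "(r * \<mu> powr (- (1 / p)) * real CARD('n)) ^ m \<le> L * K"
proof -
  define \<Omega> where "\<Omega> = (lp_ball p :: (complex ^ 'n) set)"
  define A where "A = (degree_indices m :: ('n \<Rightarrow> nat) set)"
  define c where "c = \<mu> powr (- (1 / p))"
  define a where "a \<alpha> = (if \<alpha> \<in> A then (of_real (\<epsilon> \<alpha>) * of_nat (card (arrangements \<alpha>))) *\<^sub>C x else 0)" for \<alpha>
  define f where "f z = signed_form m \<epsilon> z *\<^sub>C x" for z
  have "0 < \<mu>" using assms by (meson of_nat_0_le_iff le_less_trans)
  have "0 \<le> c" by (simp add: c_def)
  have fK: "norm (f z) \<le> K * norm x" if "z \<in> \<Omega>" for z
    using K that by (auto simp: f_def norm_scaleC \<Omega>_def intro: mult_right_mono)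
  have "holomorphic_vec_on f \<Omega>"
    unfolding f_def by (intro holomorphic_vec_scaleC holomorphic_signed_form)
  moreover have "bounded (f ` \<Omega>)"
    using fK by (auto simp: bounded_iff)
  moreover have "power_series_expansion_on f a \<Omega>"
    unfolding f_def a_def A_def by (rule power_series_signed_form)
  ultimately have "(\<Sum>\<^sub>\<infinity>\<alpha>. SUP z\<in>(\<lambda>z. r *\<^sub>R z) ` \<Omega>. ennreal (norm (mpower z \<alpha> *\<^sub>C a \<alpha>)))
      \<le> ennreal L * (SUP z\<in>\<Omega>. ennreal (norm (f z)))"
    using bohr unfolding bohr_inequality_def \<Omega>_def by blast
  then have "(\<Sum>\<alpha>\<in>A. SUP z\<in>(\<lambda>z. r *\<^sub>R z) ` \<Omega>. ennreal (norm (mpower z \<alpha> *\<^sub>C a \<alpha>)))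
      \<le> ennreal L * (SUP z\<in>\<Omega>. ennreal (norm (f z)))"
    unfolding infsum_ennreal_le_iff by (simp add: A_def finite_degree_indices)
  also have "\<dots> \<le> ennreal L * ennreal (K * norm x)"
    using fK by (intro mult_left_mono SUP_least ennreal_leI) auto
  finally have upper: "(\<Sum>\<alpha>\<in>A. SUP z\<in>(\<lambda>z. r *\<^sub>R z) ` \<Omega>. ennreal (norm (mpower z \<alpha> *\<^sub>C a \<alpha>)))
      \<le> ennreal (L * (K * norm x))" using assms by (simp add: ennreal_mult)
  have "(\<Sum>\<alpha>\<in>A. ennreal (real (card (arrangements \<alpha>)) * ((r * c) ^ m * norm x)))
      \<le> (\<Sum>\<alpha>\<in>A. SUP z\<in>(\<lambda>z. r *\<^sub>R z) ` \<Omega>. ennreal (norm (mpower z \<alpha> *\<^sub>C a \<alpha>)))"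
  proof (rule sum_mono)
    fix \<alpha> assume \<alpha>: "\<alpha> \<in> A"
    then have deg: "(\<Sum>i\<in>UNIV. \<alpha> i) = m" unfolding A_def by (rule sum_degree_indices)
    \<comment> \<open>At most \<open>m\<close> coordinates of \<open>w\<close> are nonzero, and \<open>m < \<mu>\<close> puts \<open>w\<close> inside the open ball.\<close>
    define w :: "complex ^ 'n" where "w = (\<chi> i. if \<alpha> i = 0 then 0 else of_real c)"
    have "w \<in> \<Omega>"
    proof -
      have "c powr p = 1 / \<mu>"
        unfolding c_def powr_powr using \<open>0 < \<mu>\<close> assms by (simp add: powr_minus_divide)
      \<comment> \<open>On the support of \<alpha> the exponent is at least 1, so 1/\<mu> may be
        enlarged to \<open>\<alpha> i / \<mu>\<close>; these bounds sum to m/\<mu>.\<close>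
      then have "cmod (w $ i) powr p \<le> real (\<alpha> i) / \<mu>" for i
        using \<open>0 < \<mu>\<close> \<open>0 \<le> c\<close> by (simp add: w_def divide_right_mono Suc_le_eq)
      then have "(\<Sum>i\<in>UNIV. cmod (w $ i) powr p) \<le> (\<Sum>i\<in>UNIV. real (\<alpha> i) / \<mu>)" by (rule sum_mono)
      also have "\<dots> = real m / \<mu>" by (simp add: deg flip: sum_divide_distrib of_nat_sum)
      also have "\<dots> < 1" using assms \<open>0 < \<mu>\<close> by simp
      finally show ?thesis using assms(2) by (simp add: \<Omega>_def lp_ball_iff)
    qed
    have "mpower w \<alpha> = (\<Prod>i\<in>UNIV. of_real c ^ \<alpha> i)"
      unfolding mpower_def w_def by (intro prod.cong) auto
    also have "\<dots> = of_real c ^ m" by (simp add: deg flip: power_sum)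
    finally have "norm (mpower (r *\<^sub>R w) \<alpha> *\<^sub>C a \<alpha>) = real (card (arrangements \<alpha>)) * ((r * c) ^ m * norm x)"
      using \<alpha> \<epsilon> assms \<open>0 \<le> c\<close>
      by (simp add: mpower_scaleR deg a_def norm_scaleC norm_mult norm_power power_mult_distrib)
    then show "ennreal (real (card (arrangements \<alpha>)) * ((r * c) ^ m * norm x))
        \<le> (SUP z\<in>(\<lambda>z. r *\<^sub>R z) ` \<Omega>. ennreal (norm (mpower z \<alpha> *\<^sub>C a \<alpha>)))"
      using \<open>w \<in> \<Omega>\<close> by (intro SUP_upper2[of "r *\<^sub>R w"]) auto
  qed
  also have "(\<Sum>\<alpha>\<in>A. ennreal (real (card (arrangements \<alpha>)) * ((r * c) ^ m * norm x)))
      = ennreal (\<Sum>\<alpha>\<in>A. real (card (arrangements \<alpha>)) * ((r * c) ^ m * norm x))"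
    using assms \<open>0 \<le> c\<close> by (intro sum_ennreal) simp
  also have "(\<Sum>\<alpha>\<in>A. real (card (arrangements \<alpha>)) * ((r * c) ^ m * norm x))
      = real (CARD('n) ^ m) * ((r * c) ^ m * norm x)"
    unfolding A_def by (simp only: sum_distrib_right[symmetric] of_nat_sum[symmetric] sum_card_arrangements)
  finally have "ennreal (real (CARD('n) ^ m) * ((r * c) ^ m * norm x)) \<le> ennreal (L * (K * norm x))"
    using upper by (rule order_trans)
  then have "real (CARD('n) ^ m) * ((r * c) ^ m * norm x) \<le> L * (K * norm x)"
    using assms by (simp add: ennreal_le_iff)
  then have "(real (CARD('n) ^ m) * (r * c) ^ m) * norm x \<le> (L * K) * norm x"
    by (simp only: mult.assoc)
  then have "real (CARD('n) ^ m) * (r * c) ^ m \<le> L * K"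
    by (rule mult_right_le_imp_le) (use \<open>x \<noteq> 0\<close> in simp)
  then show ?thesis by (simp add: c_def power_mult_distrib mult_ac)
qed

lemma signed_form_scaleR: "signed_form m \<epsilon> (t *\<^sub>R z) = of_real t ^ m * signed_form m \<epsilon> z"
  unfolding signed_form_def sum_distrib_left
  by (intro sum.cong) (simp_all add: mpower_scaleR sum_degree_indices mult_ac)

text \<open>All that remains after \<open>bohr_coefficient_bound\<close> is to take m-th roots. With
  m close to ln n, the factors 7m and \<open>sqrt n\<close> are at most 7^m and e^m, so they cost
  only the constant 7e, while the root of \<open>sqrt (fact m)\<close> is at most
  \<open>sqrt \<mu>\<close>.\<close>

lemma bohr_inequality_imp_le:
  fixes x :: "'x::complex_banach"
  assumes "x \<noteq> 0" "1 \<le> p" "1 \<le> L" "0 \<le> r" "2 \<le> CARD('n::finite)"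
    and bohr: "bohr_inequality TYPE('x) (lp_ball p :: (complex ^ 'n) set) L r"
  shows "r \<le> 7 * exp 1 * L * real CARD('n) powr max 0 (1 / 2 - 1 / p)
    * (8 / 5 * ln (real CARD('n))) powr (1 / 2 + 1 / p) / real CARD('n)"
proof -
  define n where "n = real CARD('n)"
  \<comment> \<open>The maximum with 1 matters for n = 2, where the integer part of ln n is
    0.\<close>
  define m where "m = max 1 (nat \<lfloor>ln n\<rfloor>)"
  \<comment> \<open>The factor 8/5 makes m < \<mu> hold for every n \<ge> 2: in the tightest case m
    = 1, the bound ln n \<ge> 2/3 gives \<mu> \<ge> 16/15.\<close>
  define \<mu> where "\<mu> = 8 / 5 * ln n"
  define \<kappa> where "\<kappa> = n powr max 0 (1 / 2 - 1 / p)"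
  define T where "T = 7 * sqrt (fact m) * real m * sqrt n"
  have n: "2 \<le> n" using assms by (simp add: n_def)
  have ln_n: "2 / 3 \<le> ln n"
  proof -
    have "ln 2 \<le> ln n" using n by simp
    then show ?thesis using ln2_ge_two_thirds by linarith
  qed
  have "1 \<le> m" by (simp add: m_def)
  have m_ge: "ln n \<le> real m + 1"
    unfolding m_def using ln_n by linarith
  have m_less: "real m < \<mu>"
    unfolding m_def \<mu>_def using ln_n by linarith
  then have "0 < \<mu>" by linarith
  have "1 \<le> \<kappa>" unfolding \<kappa>_def using n by (intro ge_one_powr_ge_zero) auto
  have "0 \<le> T" using n by (simp add: T_def)
  obtain \<epsilon> where \<epsilon>: "\<forall>\<alpha>. \<epsilon> \<alpha> \<in> {1, -1}"
    and T: "\<And>z :: complex ^ 'n. (\<Sum>i\<in>UNIV. (cmod (z $ i))\<^sup>2) \<le> 1 \<Longrightarrow> cmod (signed_form m \<epsilon> z) \<le> T"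
    using exists_signs_form_le[of m, where 'n = 'n] \<open>1 \<le> m\<close> assms m_ge
    unfolding T_def n_def by auto
  have K: "cmod (signed_form m \<epsilon> z) \<le> \<kappa> ^ m * T" if z: "z \<in> lp_ball p" for z
  proof -
    \<comment> \<open>Dividing by \<kappa> moves the point into the Euclidean unit ball; homogeneity
      restores the factor \<kappa>^m.\<close>
    have "(\<Sum>i\<in>UNIV. (cmod (((1 / \<kappa>) *\<^sub>R z) $ i))\<^sup>2) = (\<Sum>i\<in>UNIV. (cmod (z $ i))\<^sup>2) / \<kappa>\<^sup>2"
      using \<open>1 \<le> \<kappa>\<close> by (simp add: power_divide sum_divide_distrib)
    also have "\<dots> \<le> 1"
      using lp_ball_sum_squares_le[OF \<open>1 \<le> p\<close> z] \<open>1 \<le> \<kappa>\<close> unfolding \<kappa>_def n_def by (simp add: divide_le_eq)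
    finally have "cmod (signed_form m \<epsilon> ((1 / \<kappa>) *\<^sub>R z)) \<le> T" by (rule T)
    moreover have "signed_form m \<epsilon> z = of_real \<kappa> ^ m * signed_form m \<epsilon> ((1 / \<kappa>) *\<^sub>R z)"
      using \<open>1 \<le> \<kappa>\<close> by (simp flip: signed_form_scaleR)
    ultimately show ?thesis
      using \<open>1 \<le> \<kappa>\<close> by (simp add: norm_mult norm_power mult_left_mono)
  qed
  have "T \<le> (7 * exp 1 * sqrt \<mu>) ^ m"
  proof -
    have "7 * real m \<le> 7 ^ m"
      using \<open>1 \<le> m\<close>
    proof (induction m rule: dec_induct)
      case (step k)
      then show ?case by simp
    qed simp
    moreover have "sqrt n \<le> exp 1 ^ m"
    proof (rule real_le_lsqrt)
      \<comment> \<open>Here ln n \<le> m + 1 \<le> 2m, because m \<ge> 1.\<close>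
      have "n = exp (ln n)" using n by simp
      also have "\<dots> \<le> exp (real m * 2)" using m_ge \<open>1 \<le> m\<close> by simp
      also have "\<dots> = (exp 1 ^ m)\<^sup>2" by (simp flip: exp_of_nat_mult power_mult)
      finally show "n \<le> (exp 1 ^ m)\<^sup>2" .
    qed simp
    moreover have "sqrt (fact m) \<le> sqrt \<mu> ^ m"
    proof -
      have "fact m \<le> real m ^ m" using fact_le_power[of m, where 'a = real] by simp
      also have "\<dots> \<le> \<mu> ^ m" using m_less by (intro power_mono) auto
      finally show ?thesis by (simp flip: real_sqrt_power)
    qed
    ultimately have "(7 * real m) * sqrt n * sqrt (fact m) \<le> 7 ^ m * exp 1 ^ m * sqrt \<mu> ^ m"
      using n by (intro mult_mono) auto
    then show ?thesis by (simp add: T_def power_mult_distrib mult_ac)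
  qed
  then have "\<kappa> ^ m * T \<le> \<kappa> ^ m * (7 * exp 1 * sqrt \<mu>) ^ m"
    using \<open>1 \<le> \<kappa>\<close> by (intro mult_left_mono) auto
  \<comment> \<open>Weakening L to L^m makes the whole right-hand side an m-th power.\<close>
  moreover have "L \<le> L ^ m" using \<open>1 \<le> L\<close> \<open>1 \<le> m\<close> by (simp add: self_le_power)
  ultimately have "L * (\<kappa> ^ m * T) \<le> L ^ m * (\<kappa> ^ m * (7 * exp 1 * sqrt \<mu>) ^ m)"
    using \<open>1 \<le> L\<close> \<open>1 \<le> \<kappa>\<close> \<open>0 \<le> T\<close> by (intro mult_mono) auto
  moreover have "(r * \<mu> powr (- (1 / p)) * n) ^ m \<le> L * (\<kappa> ^ m * T)"
    unfolding n_def
  proof (rule bohr_coefficient_bound[OF \<open>x \<noteq> 0\<close> \<open>1 \<le> p\<close> _ \<open>0 \<le> r\<close> _ m_less bohr _ K])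
    show "\<bar>\<epsilon> \<alpha>\<bar> = 1" for \<alpha> using \<epsilon>[rule_format, of \<alpha>] by auto
  qed (use \<open>1 \<le> L\<close> \<open>0 \<le> T\<close> \<open>1 \<le> \<kappa>\<close> in simp_all)
  ultimately have "(r * \<mu> powr (- (1 / p)) * n) ^ m \<le> (L * (\<kappa> * (7 * exp 1 * sqrt \<mu>))) ^ m"
    by (simp add: power_mult_distrib)
  then have le: "r * \<mu> powr (- (1 / p)) * n \<le> L * (\<kappa> * (7 * exp 1 * sqrt \<mu>))"
    using \<open>1 \<le> m\<close> \<open>1 \<le> L\<close> \<open>1 \<le> \<kappa>\<close> \<open>0 < \<mu>\<close> n \<open>0 \<le> r\<close> by (subst (asm) power_mono_iff) auto
  \<comment> \<open>Solving for r moves \<mu>^(1/p) to the right, where it joins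
    \<open>sqrt \<mu>\<close> to give the exponent 1/2 + 1/p.\<close>
  have "r = (r * \<mu> powr (- (1 / p)) * n) * (\<mu> powr (1 / p) / n)"
    using n \<open>0 < \<mu>\<close> by (simp add: powr_minus)
  also have "\<dots> \<le> L * (\<kappa> * (7 * exp 1 * sqrt \<mu>)) * (\<mu> powr (1 / p) / n)"
    using le n by (intro mult_right_mono) auto
  also have "\<dots> = 7 * exp 1 * L * \<kappa> * \<mu> powr (1 / 2 + 1 / p) / n"
    using \<open>0 < \<mu>\<close> by (simp add: powr_add powr_half_sqrt)
  finally show ?thesis unfolding \<kappa>_def \<mu>_def n_def .
qed

text \<open>Since p \<ge> 1, the exponent is at most 3/2. The rational bounds sqrt(8/5) \<le> 13/10,
  e \<ge> 5/2 and sqrt 2 \<ge> 7/5 then reduce the claim, after cancelling one factor e, to 14.56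
  \<le> 17.5.\<close>

lemma bohr_constant_le:
  assumes "1 \<le> p"
  shows "7 * exp 1 * (8 / 5) powr (1 / 2 + 1 / p) \<le> exp 3 * 2 powr (3 / 2 :: real)"
proof -
  have "1 / p \<le> 1" using assms by simp
  then have "(8 / 5) powr (1 / 2 + 1 / p) \<le> (8 / 5 :: real) powr (1 + 1 / 2)"
    by (intro powr_mono) linarith+
  also have "\<dots> = 8 / 5 * sqrt (8 / 5)" unfolding powr_add by (simp add: powr_half_sqrt)
  also have "\<dots> \<le> 8 / 5 * (13 / 10)"
    by (intro mult_left_mono real_le_lsqrt) (auto simp: power2_eq_square)
  finally have "7 * (8 / 5) powr (1 / 2 + 1 / p) \<le> (5 / 2)\<^sup>2 * (2 * (7 / 5 :: real))"
    by (simp add: power2_eq_square)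
  also have "\<dots> \<le> exp 2 * 2 powr (3 / 2)"
  proof (intro mult_mono)
    have "(5 / 2)\<^sup>2 \<le> (exp 1 :: real)\<^sup>2"
      using exp_lower_Taylor_quadratic[of "1 :: real"] by (intro power_mono) auto
    then show "(5 / 2)\<^sup>2 \<le> exp (2 :: real)" by (simp flip: exp_of_nat_mult)
    have "7 / 5 \<le> sqrt 2" by (intro real_le_rsqrt) (simp add: power2_eq_square)
    then have "2 * (7 / 5) \<le> 2 * sqrt 2" by simp
    also have "\<dots> = 2 powr (1 + 1 / 2)" unfolding powr_add by (simp add: powr_half_sqrt)
    finally show "2 * (7 / 5) \<le> 2 powr (3 / 2 :: real)" by simp
  qed auto
  finally have "exp 1 * (7 * (8 / 5) powr (1 / 2 + 1 / p)) \<le> exp 1 * (exp 2 * 2 powr (3 / 2 :: real))"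
    by (intro mult_left_mono) auto
  also have "\<dots> = exp 3 * 2 powr (3 / 2)" by (simp flip: exp_add mult.assoc)
  finally show ?thesis by (simp add: mult_ac)
qed

text \<open>Both ranges of p are covered by one formula, in which the power of the dimension records
  the inclusion of the l_p ball in a multiple of the Euclidean ball.\<close>

lemma bohr_radius_lp_ball_le:
  assumes "\<exists>x :: 'x::complex_banach. x \<noteq> 0" "1 \<le> p" "1 \<le> L" "1 < CARD('n::finite)"
  shows "bohr_radius (lp_ball p :: (complex ^ 'n) set) TYPE('x) L
    \<le> L * exp 3 * 2 powr (3 / 2) * (real CARD('n) powr max 0 (1 / 2 - 1 / p)
        * ln (real CARD('n)) powr (1 / 2 + 1 / p) / real CARD('n))"
proof (rule bohr_radius_le)
  show "0 \<in> (lp_ball p :: (complex ^ 'n) set)" using assms by (simp add: lp_ball_iff)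
next
  fix r :: real
  assume r: "0 \<le> r" "bohr_inequality TYPE('x) (lp_ball p :: (complex ^ 'n) set) L r"
  define n where "n = real CARD('n)"
  have n: "1 < n" using assms by (simp add: n_def)
  define Q where "Q = L * (n powr max 0 (1 / 2 - 1 / p) * ln n powr (1 / 2 + 1 / p) / n)"
  obtain x :: 'x where "x \<noteq> 0" using assms by blast
  then have "r \<le> 7 * exp 1 * L * n powr max 0 (1 / 2 - 1 / p) * (8 / 5 * ln n) powr (1 / 2 + 1 / p) / n"
    unfolding n_def using assms r by (intro bohr_inequality_imp_le) auto
  also have "\<dots> = 7 * exp 1 * (8 / 5) powr (1 / 2 + 1 / p) * Q"
    unfolding powr_mult by (simp add: Q_def)
  also have "\<dots> \<le> exp 3 * 2 powr (3 / 2) * Q"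
    using assms n by (intro mult_right_mono bohr_constant_le) (auto simp: Q_def)
  finally show "r \<le> L * exp 3 * 2 powr (3 / 2) * (real CARD('n) powr max 0 (1 / 2 - 1 / p)
        * ln (real CARD('n)) powr (1 / 2 + 1 / p) / real CARD('n))"
    by (simp add: Q_def n_def mult_ac)
qed (use assms lp_ball_coord_le in auto)

theorem theorem2p12:
  fixes p L :: real
  assumes "\<exists>x :: 'x::complex_banach. x \<noteq> 0"
    and "\<exists>N (e :: nat \<Rightarrow> 'x). schauder_basis N e"
    and "1 \<le> p" and "CARD('n::finite) > 1" and "1 \<le> L"
  shows "(p \<le> 2 \<longrightarrow>
            bohr_radius (lp_ball p :: (complex ^ 'n) set) TYPE('x) L
              \<le> L * exp 3 * 2 powr (3 / 2) * ((ln (real CARD('n))) powr (1 / 2 + 1 / p) / real CARD('n))) \<and>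
         (2 \<le> p \<longrightarrow>
            bohr_radius (lp_ball p :: (complex ^ 'n) set) TYPE('x) L
              \<le> L * exp 3 * 2 powr (3 / 2) * (ln (real CARD('n)) / real CARD('n)) powr (1 / 2 + 1 / p))"
proof (intro conjI impI)
  note bound = bohr_radius_lp_ball_le[OF assms(1,3,5,4)]
  define n where "n = real CARD('n)"
  have n: "1 < n" using assms by (simp add: n_def)
  {
    assume "p \<le> 2"
    then have "max 0 (1 / 2 - 1 / p) = 0" using assms by (simp add: field_simps)
    then show "bohr_radius (lp_ball p :: (complex ^ 'n) set) TYPE('x) L
        \<le> L * exp 3 * 2 powr (3 / 2) * ((ln (real CARD('n))) powr (1 / 2 + 1 / p) / real CARD('n))"
      using bound by simp
  next
    assume "2 \<le> p"
    \<comment> \<open>In this form the power of n divided by n becomes n to the exponent -(1/2 +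
      1/p), which matches the exponent of ln n.\<close>
    then have mx: "max 0 (1 / 2 - 1 / p) = 1 - (1 / 2 + 1 / p)" by (simp add: field_simps)
    have "n powr max 0 (1 / 2 - 1 / p) * ln n powr (1 / 2 + 1 / p) / n = (ln n / n) powr (1 / 2 + 1 / p)"
      unfolding mx powr_diff using n by (simp add: powr_divide)
    then show "bohr_radius (lp_ball p :: (complex ^ 'n) set) TYPE('x) L
        \<le> L * exp 3 * 2 powr (3 / 2) * (ln (real CARD('n)) / real CARD('n)) powr (1 / 2 + 1 / p)"
      using bound unfolding n_def by simp
  }
qed

end
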